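(* Let $N\ge2$ and $0\le n\le N$, $k=N-n$. (i) The operators $\{\boldsymbol s_j\}_{j=1}^N$, $\boldsymbol s_j=s_j\hat r_j$, define a level-0 action of the affine symmetric group $\hat{\mathbb S}_N$ on $\mathcal V_n$ (with $q$ inverted), with the action of $\boldsymbol s_N$ depending on $q$. (ii) The corresponding $\mathbb S_N$-action (by $\boldsymbol s_1,\dots,\boldsymbol s_{N-1}$) commutes with the Yang–Baxter algebra: $\boldsymbol s_jM=M\boldsymbol s_j$ for $j=1,\dots,N-1$, i.e. $\boldsymbol s_j$ commutes with each of the operators $A(x),B(x),C(x),D(x)$ on $\mathcal V$; and the $\hat{\mathbb S}_N$-action commutes with the transfer matrices: $\boldsymbol s_jH(x)=H(x)\boldsymbol s_j$ and $\boldsymbol s_jE(x)=E(x)\boldsymbol s_j$ for $j=1,\dots,N$. (iii) The $\mathbb S_N$-action permutes the Bethe vectors according to the natural $\mathbb S_N$-action on the cosets $[w]\in\mathbb S_N/(\mathbb S_n\times\mathbb S_k)$, i.e. $\boldsymbol s_jY_{[w]}=Y_{[s_jw]}$ for $j=1,\dots,N-1$.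
   Context: Set $\Lambda=\mathbb Z[T_1,\dots,T_N]$, $t_i:=T_{N+1-i}$. $\mathcal V=\Lambda[q]\otimes V^{\otimes N}$ is the free $\Lambda[q]$-module with basis $v_{\varepsilon_1}\otimes\cdots\otimes v_{\varepsilon_N}$, $\varepsilon_j\in\{0,1\}$; $\mathcal V_n$ is the span of those with $\sum\varepsilon_j=n$. $\sigma^+v_0=v_1$, $\sigma^+v_1=0$, $\sigma^-v_1=v_0$, $\sigma^-v_0=0$; $\sigma_j^\pm$ acts on the $j$-th factor. Affine symmetric group: $s_j$ ($1\le j\le N-1$) acts on $\Lambda$ by exchanging $t_j,t_{j+1}$, and $s_N$ exchanges $t_N,t_1$ (level 0); these are extended to $\mathcal V$ by acting trivially on $V^{\otimes N}$ and on $q$. The braid matrices are $\hat r_j=1-(t_j-t_{j+1})\sigma_j^+\sigma_{j+1}^-$ for $1\le j\le N-1$ and $\hat r_N=1-q^{-1}(t_N-t_1)\sigma_N^+\sigma_1^-$. Monodromy matrices: $M(x)=L_N(x)\cdots L_1(x)=\begin{pmatrix}A&B\\C&D\end{pmatrix}$, $M'(x)=L_N'(x)\cdots L_1'(x)=\begin{pmatrix}A'&B'\\C'&D'\end{pmatrix}$ (products of $2\times2$ matrices with operator entries), where $$L_j(x)=\begin{pmatrix}1-xt_j\sigma_j^-\sigma_j^+ & x\sigma_j^+\\ \sigma_j^- & x\sigma_j^-\sigma_j^+\end{pmatrix},\qquad L'_j(x)=\begin{pmatrix}1+xt_j\sigma_j^+\sigma_j^- & x\sigma_j^+\\ \sigma_j^-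 & x\sigma_j^+\sigma_j^-\end{pmatrix}.$$ Transfer matrices: $H=A+qD$, $E=A'+qD'$. Partitions: $\Pi_{n,k}=\{\lambda:k\ge\lambda_1\ge\dots\ge\lambda_n\ge0\}$, $I(\lambda)=\{\lambda_{n+1-i}+i:1\le i\le n\}$, $|\lambda\rangle=v_{\varepsilon_1}\otimes\cdots\otimes v_{\varepsilon_N}$ with $\varepsilon_j=1$ iff $j\in I(\lambda)$; $\lambda^\vee=(k-\lambda_n,\dots,k-\lambda_1)$. Factorial Schur functions: $s_\lambda(x|a)=\det[(x_j|a)^{\lambda_i+n-i}]/\det[(x_j|a)^{n-i}]$ with $(x|a)^r=\prod_{i=1}^r(x-a_i)$; $s_\lambda(x|t)$ and $s_\lambda(x|T)$ mean $a=(t_1,t_2,\dots)$ and $a=(T_1,T_2,\dots)$. Bethe vectors: $\mathbb F=\mathbb C\{\!\{T_1,\dots,T_N\}\!\}$ is the algebraically closed field of Puiseux series, $\mathbb F_q=\mathbb C[q^{\pm1/N}]\widehat\otimes\mathbb F$ (completed tensor product). The Bethe roots $y_1,\dots,y_N$ are the $N$ solutions of $\prod_{j=1}^N(y-t_j)+(-1)^nq=0$, numbered so that $y_j=y_j(q)$ specialises to $t_j$ at $q=0$ (a power series in $q$ with coefficients rational in the $t$'s); permutations of the $t$'s act on them accordingly, $s_iy_j=y_{s_i(j)}$. For $\alpha\in\Pi_{n,k}$ put $y_\alpha=(y_i)_{i\in I(\alpha)}$, $|y_\alpha\rangle=\sum_{\lambda\in\Pi_{n,k}}s_{\lambda^\vee}(y_\alpha|T)|\lambda\rangle\in\mathbb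 F_q\otimes V_n$, where $V_n$ is the span of the $|\lambda\rangle$, $\mathfrak e(y_\alpha)=\prod_{i\in I(\alpha),\,j\notin I(\alpha)}(y_i-y_j)$, and $Y_\alpha=\mathfrak e(y_\alpha)^{-1}|y_\alpha\rangle$. A coset $[w]\in\mathbb S_N/(\mathbb S_n\times\mathbb S_k)$ corresponds to the $\alpha$ with $I(\alpha)=\{w(1),\dots,w(n)\}$, and $Y_{[w]}:=Y_\alpha$. *)

theory Defs
  imports
    "HOL-Library.Poly_Mapping"
    "HOL-Computational_Algebra.Formal_Laurent_Series"
    "HOL-Computational_Algebra.Fraction_Field"
    "HOL-Computational_Algebra.Polynomial"
    "HOL-Algebra.Group_Action"
    "HOL-Algebra.Sym_Groups"
    "Jordan_Normal_Form.Determinant"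
begin

section \<open>Operators on tensor space over an arbitrary ring of scalars\<close>

text \<open>
  The basis vector $v_{\varepsilon_1} \otimes \cdots \otimes v_{\varepsilon_N}$ is indexed by the
  set of positions $j$ with $\varepsilon_j = 1$, so a vector is its coefficient function.
  The operators below are polymorphic in the scalars; the parameter \<open>t\<close> gives the images of
  $t_1, \dots, t_N$, and \<open>q\<close>, \<open>qinv\<close>, \<open>x\<close> those of $q$, $q^{-1}$ and the spectral parameter.
\<close>

type_synonym 'a vec = "nat set \<Rightarrow> 'a"
type_synonym 'a operator = "'a vec \<Rightarrow> 'a vec"

definition tensor_space :: "nat \<Rightarrow> 'a::zero set \<Rightarrow> 'a vec set" where
  "tensor_space N R = {v. \<forall>S. v S \<in> R \<and> (v S \<noteq> 0 \<longrightarrow> S \<subseteq> {1..N})}"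

definition weight_space :: "nat \<Rightarrow> nat \<Rightarrow> 'a::zero set \<Rightarrow> 'a vec set" where
  "weight_space N n R = {v \<in> tensor_space N R. \<forall>S. v S \<noteq> 0 \<longrightarrow> card S = n}"

definition basis_vec :: "nat set \<Rightarrow> 'a::zero_neq_one vec" where
  "basis_vec S = (\<lambda>S'. if S' = S then 1 else 0)"

definition vec_add :: "'a::plus vec \<Rightarrow> 'a vec \<Rightarrow> 'a vec" where
  "vec_add v w = (\<lambda>S. v S + w S)"

definition vec_scale :: "'a::times \<Rightarrow> 'a vec \<Rightarrow> 'a vec" where
  "vec_scale c v = (\<lambda>S. c * v S)"

definition op_add :: "'a::plus operator \<Rightarrow> 'a operator \<Rightarrow> 'a operator" where
  "op_add F G = (\<lambda>v. vec_add (F v) (G v))"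

definition op_scale :: "'a::times \<Rightarrow> 'a operator \<Rightarrow> 'a operator" where
  "op_scale c F = (\<lambda>v. vec_scale c (F v))"

text \<open>$\sigma_j^+$ maps the basis vector of a set $S \not\ni j$ to that of $S \cup \{j\}$ and kills
  the others; on coefficient functions this is a pull-back. Dually for $\sigma_j^-$.\<close>

definition sigma_plus :: "nat \<Rightarrow> 'a::zero operator" where
  "sigma_plus j v = (\<lambda>S. if j \<in> S then v (S - {j}) else 0)"

definition sigma_minus :: "nat \<Rightarrow> 'a::zero operator" where
  "sigma_minus j v = (\<lambda>S. if j \<in> S then 0 else v (insert j S))"

definition cyc_succ :: "nat \<Rightarrow> nat \<Rightarrow> nat" where
  "cyc_succ N j = (if j = N then 1 else j + 1)"

definition braid_op :: "nat \<Rightarrow> (nat \<Rightarrow> 'a) \<Rightarrow> 'a \<Rightarrow> nat \<Rightarrow> 'a::comm_ring_1 operator" where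
  "braid_op N t qinv j =
     op_add id
       (op_scale (- ((if j = N then qinv else 1) * (t j - t (cyc_succ N j))))
         (sigma_plus j \<circ> sigma_minus (cyc_succ N j)))"

text \<open>The operator $s_j \hat r_j$; \<open>act j\<close> is the action of $s_j$ on the scalars.\<close>

definition affine_op ::
    "nat \<Rightarrow> (nat \<Rightarrow> 'a \<Rightarrow> 'a) \<Rightarrow> (nat \<Rightarrow> 'a) \<Rightarrow> 'a \<Rightarrow> nat \<Rightarrow> 'a::comm_ring_1 operator" where
  "affine_op N act t qinv j v = (\<lambda>S. act j (braid_op N t qinv j v S))"


subsection \<open>Monodromy and transfer matrices\<close>

datatype 'a op_mat =
  Op_Mat (entry_A: "'a operator") (entry_B: "'a operator")
         (entry_C: "'a operator") (entry_D: "'a operator")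

definition op_mat_one :: "'a::zero op_mat" where
  "op_mat_one = Op_Mat id (\<lambda>v S. 0) (\<lambda>v S. 0) id"

definition op_mat_mult :: "'a::plus op_mat \<Rightarrow> 'a op_mat \<Rightarrow> 'a op_mat" where
  "op_mat_mult X Y = Op_Mat
     (op_add (entry_A X \<circ> entry_A Y) (entry_B X \<circ> entry_C Y))
     (op_add (entry_A X \<circ> entry_B Y) (entry_B X \<circ> entry_D Y))
     (op_add (entry_C X \<circ> entry_A Y) (entry_D X \<circ> entry_C Y))
     (op_add (entry_C X \<circ> entry_B Y) (entry_D X \<circ> entry_D Y))"

definition lax :: "(nat \<Rightarrow> 'a) \<Rightarrow> 'a \<Rightarrow> nat \<Rightarrow> 'a::comm_ring_1 op_mat" where
  "lax t x j = Op_Mat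
     (op_add id (op_scale (- (x * t j)) (sigma_minus j \<circ> sigma_plus j)))
     (op_scale x (sigma_plus j))
     (sigma_minus j)
     (op_scale x (sigma_minus j \<circ> sigma_plus j))"

definition lax' :: "(nat \<Rightarrow> 'a) \<Rightarrow> 'a \<Rightarrow> nat \<Rightarrow> 'a::comm_ring_1 op_mat" where
  "lax' t x j = Op_Mat
     (op_add id (op_scale (x * t j) (sigma_plus j \<circ> sigma_minus j)))
     (op_scale x (sigma_plus j))
     (sigma_minus j)
     (op_scale x (sigma_plus j \<circ> sigma_minus j))"

text \<open>\<open>op_mat_prod L N\<close> is $L_N \cdots L_1$, with the later factors on the left.\<close>

primrec op_mat_prod :: "(nat \<Rightarrow> 'a::comm_ring_1 op_mat) \<Rightarrow> nat \<Rightarrow> 'a op_mat" where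
  "op_mat_prod L 0 = op_mat_one"
| "op_mat_prod L (Suc j) = op_mat_mult (L (Suc j)) (op_mat_prod L j)"

definition monodromy :: "nat \<Rightarrow> (nat \<Rightarrow> 'a) \<Rightarrow> 'a \<Rightarrow> 'a::comm_ring_1 op_mat" where
  "monodromy N t x = op_mat_prod (lax t x) N"

definition monodromy' :: "nat \<Rightarrow> (nat \<Rightarrow> 'a) \<Rightarrow> 'a \<Rightarrow> 'a::comm_ring_1 op_mat" where
  "monodromy' N t x = op_mat_prod (lax' t x) N"

definition transfer_H :: "nat \<Rightarrow> (nat \<Rightarrow> 'a) \<Rightarrow> 'a \<Rightarrow> 'a \<Rightarrow> 'a::comm_ring_1 operator" where
  "transfer_H N t q x =
     op_add (entry_A (monodromy N t x)) (op_scale q (entry_D (monodromy N t x)))"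

definition transfer_E :: "nat \<Rightarrow> (nat \<Rightarrow> 'a) \<Rightarrow> 'a \<Rightarrow> 'a \<Rightarrow> 'a::comm_ring_1 operator" where
  "transfer_E N t q x =
     op_add (entry_A (monodromy' N t x)) (op_scale q (entry_D (monodromy' N t x)))"


section \<open>The rings of scalars\<close>

subsection \<open>Polynomials in the equivariant parameters\<close>

text \<open>Polynomials in countably many variables $T_i$; $\mathbb{Z}[T_1,\dots,T_N]$ is the subring
  \<open>Lam N\<close>.\<close>

type_synonym 'c mpol = "(nat \<Rightarrow>\<^sub>0 nat) \<Rightarrow>\<^sub>0 'c"

definition T_var :: "nat \<Rightarrow> 'c::zero_neq_one mpol" where
  "T_var i = Poly_Mapping.single (Poly_Mapping.single i 1) 1"

definition Lam :: "nat \<Rightarrow> int mpol set" where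
  "Lam N = {p. \<forall>m \<in> Poly_Mapping.keys p. Poly_Mapping.keys m \<subseteq> {1..N}}"

definition swap_vars :: "nat \<Rightarrow> nat \<Rightarrow> 'c::zero mpol \<Rightarrow> 'c mpol" where
  "swap_vars a b = Poly_Mapping.map_key (Poly_Mapping.map_key (transpose a b))"

text \<open>The level-0 action of $s_j$ exchanges $t_j$ and $t_{j+1}$ (cyclically),
  where $t_i = T_{N+1-i}$.\<close>

definition s_pol :: "nat \<Rightarrow> nat \<Rightarrow> 'c::zero mpol \<Rightarrow> 'c mpol" where
  "s_pol N j = swap_vars (N + 1 - j) (N + 1 - cyc_succ N j)"


subsection \<open>Adjoining $q$, $q^{-1}$ and the spectral parameter\<close>

text \<open>$\Lambda[q,q^{-1}]$ is the group ring of $\mathbb{Z}$ over $\Lambda$: the key of a term is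
  the exponent of $q$.\<close>

type_synonym qlaurent = "int \<Rightarrow>\<^sub>0 int mpol"

definition LamQ_inv :: "nat \<Rightarrow> qlaurent set" where
  "LamQ_inv N = {p. \<forall>i. Poly_Mapping.lookup p i \<in> Lam N}"

definition LamQ :: "nat \<Rightarrow> qlaurent set" where
  "LamQ N = {p \<in> LamQ_inv N. \<forall>i \<in> Poly_Mapping.keys p. i \<ge> 0}"

definition LamQ_const :: "nat \<Rightarrow> qlaurent set" where
  "LamQ_const N = {p \<in> LamQ_inv N. Poly_Mapping.keys p \<subseteq> {0}}"

definition t_L :: "nat \<Rightarrow> nat \<Rightarrow> qlaurent" where
  "t_L N i = Poly_Mapping.single 0 (T_var (N + 1 - i))"

definition q_L :: qlaurent where
  "q_L = Poly_Mapping.single 1 1"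

definition qinv_L :: qlaurent where
  "qinv_L = Poly_Mapping.single (- 1) 1"

definition s_L :: "nat \<Rightarrow> nat \<Rightarrow> qlaurent \<Rightarrow> qlaurent" where
  "s_L N j = Poly_Mapping.map (s_pol N j)"

definition bs_L :: "nat \<Rightarrow> nat \<Rightarrow> qlaurent operator" where
  "bs_L N = affine_op N (s_L N) (t_L N) qinv_L"

text \<open>The spectral parameter $x$ is a further indeterminate, on which the symmetric group acts
  trivially.\<close>

definition poly_in_x :: "qlaurent set \<Rightarrow> qlaurent poly set" where
  "poly_in_x R = {p. \<forall>i. poly.coeff p i \<in> R}"

definition t_X :: "nat \<Rightarrow> nat \<Rightarrow> qlaurent poly" where
  "t_X N i = [:t_L N i:]"

definition q_X :: "qlaurent poly" where
  "q_X = [:q_L:]"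

definition x_X :: "qlaurent poly" where
  "x_X = [:0, 1:]"

definition bs_X :: "nat \<Rightarrow> nat \<Rightarrow> qlaurent poly operator" where
  "bs_X N = affine_op N (\<lambda>j. map_poly (s_L N j)) (t_X N) [:qinv_L:]"

definition M_X :: "nat \<Rightarrow> qlaurent poly op_mat" where
  "M_X N = monodromy N (t_X N) x_X"

definition H_X :: "nat \<Rightarrow> qlaurent poly operator" where
  "H_X N = transfer_H N (t_X N) q_X x_X"

definition E_X :: "nat \<Rightarrow> qlaurent poly operator" where
  "E_X N = transfer_E N (t_X N) q_X x_X"


subsection \<open>The field of the Bethe roots\<close>

text \<open>The Bethe roots are power series in $q$ whose coefficients are rational in the $t$'s, so the
  Bethe vectors have entries in $\mathbb{C}(T)(\!(q)\!)$. The symmetric group acts on this subfield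
  of the completion of $\mathbb{C}[q^{\pm 1/N}] \otimes \mathbb{F}$ by permuting the $t$'s in each
  coefficient; there is no such action on a field of multivariate Puiseux series, whose construction
  is not symmetric in the variables.\<close>

type_synonym ratfun = "complex mpol fract"
type_synonym bfield = "ratfun fls"

definition T_K :: "nat \<Rightarrow> ratfun" where
  "T_K i = Fract (T_var i) 1"

definition T_B :: "nat \<Rightarrow> bfield" where
  "T_B i = fls_const (T_K i)"

definition t_B :: "nat \<Rightarrow> nat \<Rightarrow> bfield" where
  "t_B N i = T_B (N + 1 - i)"

definition s_K :: "nat \<Rightarrow> nat \<Rightarrow> ratfun \<Rightarrow> ratfun" where
  "s_K N j r = (THE r'. \<exists>a b. b \<noteq> 0 \<and> r = Fract a b \<and> r' = Fract (s_pol N j a) (s_pol N j b))"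

definition s_B :: "nat \<Rightarrow> nat \<Rightarrow> bfield \<Rightarrow> bfield" where
  "s_B N j f = Abs_fls (\<lambda>i. s_K N j (fls_nth f i))"

definition bs_B :: "nat \<Rightarrow> nat \<Rightarrow> bfield operator" where
  "bs_B N = affine_op N (s_B N) (t_B N) (inverse fls_X)"


section \<open>The affine symmetric group\<close>

text \<open>The group generated by involutions $s_1,\dots,s_N$ subject to the Coxeter relations of the
  cyclic Dynkin diagram (no relation between $s_1$ and $s_2$ if $N = 2$), realised as classes of
  words in the generators.\<close>

inductive word_eq :: "nat \<Rightarrow> nat list \<Rightarrow> nat list \<Rightarrow> bool" for N :: nat where
  refl: "word_eq N u u"
| sym: "word_eq N u v \<Longrightarrow> word_eq N v u"
| trans: "word_eq N u v \<Longrightarrow> word_eq N v w \<Longrightarrow> word_eq N u w"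
| invol: "j \<in> {1..N} \<Longrightarrow> word_eq N (u @ [j, j] @ v) (u @ v)"
| braid: "N \<ge> 3 \<Longrightarrow> j \<in> {1..N} \<Longrightarrow>
    word_eq N (u @ [j, cyc_succ N j, j] @ v) (u @ [cyc_succ N j, j, cyc_succ N j] @ v)"
| commute: "i \<in> {1..N} \<Longrightarrow> j \<in> {1..N} \<Longrightarrow> i \<noteq> j \<Longrightarrow> cyc_succ N i \<noteq> j \<Longrightarrow> cyc_succ N j \<noteq> i \<Longrightarrow>
    word_eq N (u @ [i, j] @ v) (u @ [j, i] @ v)"

definition word_rel :: "nat \<Rightarrow> (nat list \<times> nat list) set" where
  "word_rel N = {(u, v). u \<in> lists {1..N} \<and> v \<in> lists {1..N} \<and> word_eq N u v}"

definition affine_sym :: "nat \<Rightarrow> nat list set monoid" where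
  "affine_sym N =
     \<lparr>carrier = lists {1..N} // word_rel N,
      mult = (\<lambda>A B. \<Union>u \<in> A. \<Union>v \<in> B. word_rel N `` {u @ v}),
      one = word_rel N `` {[]}\<rparr>"

definition affine_gen :: "nat \<Rightarrow> nat \<Rightarrow> nat list set" where
  "affine_gen N j = word_rel N `` {[j]}"


section \<open>Bethe vectors\<close>

definition partitions :: "nat \<Rightarrow> nat \<Rightarrow> nat list set" where
  "partitions n k = {la. length la = n \<and> sorted_wrt (\<ge>) la \<and> (\<forall>a \<in> set la. a \<le> k)}"

text \<open>$\{\lambda_{n+1-i} + i : 1 \le i \le n\}$; list positions count from 0.\<close>

definition part_set :: "nat list \<Rightarrow> nat set" where
  "part_set la = {la ! (length la - i) + i | i. 1 \<le> i \<and> i \<le> length la}"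

definition part_dual :: "nat \<Rightarrow> nat list \<Rightarrow> nat list" where
  "part_dual k la = rev (map (\<lambda>a. k - a) la)"

definition factorial_power :: "'a::comm_ring_1 \<Rightarrow> (nat \<Rightarrow> 'a) \<Rightarrow> nat \<Rightarrow> 'a" where
  "factorial_power x a r = (\<Prod>i = 1..r. x - a i)"

definition factorial_schur :: "nat list \<Rightarrow> 'a::field list \<Rightarrow> (nat \<Rightarrow> 'a) \<Rightarrow> 'a" where
  "factorial_schur la xs a = (let n = length la in
     det (mat n n (\<lambda>(i, j). factorial_power (xs ! j) a (la ! i + (n - Suc i)))) /
     det (mat n n (\<lambda>(i, j). factorial_power (xs ! j) a (n - Suc i))))"

definition bethe_root :: "nat \<Rightarrow> nat \<Rightarrow> nat \<Rightarrow> bfield" where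
  "bethe_root N n j = fps_to_fls (THE y.
     (\<Prod>i = 1..N. y - fps_const (T_K (N + 1 - i))) + (- 1) ^ n * fps_X = 0 \<and>
     fps_nth y 0 = T_K (N + 1 - j))"

definition bethe_tuple :: "nat \<Rightarrow> nat \<Rightarrow> nat list \<Rightarrow> bfield list" where
  "bethe_tuple N n \<alpha> = map (bethe_root N n) (sorted_list_of_set (part_set \<alpha>))"

definition bethe_vec :: "nat \<Rightarrow> nat \<Rightarrow> nat list \<Rightarrow> bfield vec" where
  "bethe_vec N n \<alpha> = (\<lambda>S. \<Sum>la \<in> partitions n (N - n).
     factorial_schur (part_dual (N - n) la) (bethe_tuple N n \<alpha>) T_B * basis_vec (part_set la) S)"

definition bethe_euler :: "nat \<Rightarrow> nat \<Rightarrow> nat list \<Rightarrow> bfield" where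
  "bethe_euler N n \<alpha> =
     (\<Prod>i \<in> part_set \<alpha>. \<Prod>j \<in> {1..N} - part_set \<alpha>. bethe_root N n i - bethe_root N n j)"

definition bethe_Y :: "nat \<Rightarrow> nat \<Rightarrow> nat list \<Rightarrow> bfield vec" where
  "bethe_Y N n \<alpha> = vec_scale (inverse (bethe_euler N n \<alpha>)) (bethe_vec N n \<alpha>)"

text \<open>$\mathbb{S}_n \times \mathbb{S}_k$, $k = N - n$, as the subgroup preserving $\{1,\dots,n\}$
  (and hence $\{n+1,\dots,N\}$).\<close>

definition block_subgroup :: "nat \<Rightarrow> nat \<Rightarrow> (nat \<Rightarrow> nat) set" where
  "block_subgroup N n = {w \<in> carrier (sym_group N). w ` {1..n} = {1..n}}"

definition coset_of :: "nat \<Rightarrow> nat \<Rightarrow> (nat \<Rightarrow> nat) \<Rightarrow> (nat \<Rightarrow> nat) set" where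
  "coset_of N n w = w <#\<^bsub>sym_group N\<^esub> block_subgroup N n"

definition coset_part :: "nat \<Rightarrow> nat \<Rightarrow> (nat \<Rightarrow> nat) set \<Rightarrow> nat list" where
  "coset_part N n C = (THE \<alpha>. \<alpha> \<in> partitions n (N - n) \<and> (\<forall>w \<in> C. part_set \<alpha> = w ` {1..n}))"

definition Y_coset :: "nat \<Rightarrow> nat \<Rightarrow> (nat \<Rightarrow> nat) set \<Rightarrow> bfield vec" where
  "Y_coset N n C = bethe_Y N n (coset_part N n C)"

end

theory Submission
  imports Defs "Jordan_Normal_Form.Char_Poly"
begin

text \<open>On coefficient functions the operator $s_j \hat r_j$ applies $s_j$ to the scalars after adding to
the coefficient of a set $S$ with $j \in S$, $j + 1 \notin S$ a multiple of the coefficient of the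
set $S'$ in which $j$ is replaced by $j+1$. Everything is deduced from this description, for a
ring endomorphism $s$, a scalar $c$ and two sites $a \ne b$ in place of $s_j$, $t_j - t_{j+1}$, $j$,
$j + 1$; the case $j = N$ then differs from the others only by a factor $q^{-1}$ in $c$.

(i) The Coxeter relations (\<open>exchange_op_involution\<close>, \<open>exchange_op_far_commute\<close>,
\<open>exchange_op_braid\<close>) come from $e_j = \sigma_j^+ \sigma_{j+1}^-$ satisfying $e_j^2 = 0$ and
$e_j e_{j+1} e_j = 0 = e_{j+1} e_j e_{j+1}$: the matrices $1 - u e_j$ solve the Yang--Baxter
equation with additive spectral parameters, and $s_j$ moves these parameters as required. Words in
the generators then act (\<open>affine_sym_action\<close>).

(ii) The operator $s_j \hat r_j$ commutes with the entries of $L_{j+1} L_j$, a check on the four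
states of two sites (\<open>exchange_op_commute_two_lax\<close>), and with those of the other $L_i$. Hence for
$j < N$ it commutes with the monodromy matrix. For $j = N$ the two sites are at opposite ends of the product,
but the transfer matrix is a trace twisted by $\mathrm{diag}(1, q)$; turning the trace
around makes them adjacent with the twist in between (\<open>twisted_trace_cyclic\<close>), and the twist
absorbs the factor $q^{-1}$ of $\hat r_N$.

(iii) The coordinate of $|y_\alpha\rangle$ at $|\lambda\rangle$ is an alternant in factorial powers
divided by a Vandermonde determinant; the degrees of its rows are the numbers $N - i$ with
$i \in I(\lambda)$. Exchanging two consecutive parameters $a_m$, $a_{m+1}$ changes the factorial
power of degree $m$ only, by a multiple of the one of degree $m - 1$. So for $m = N - j$ the
exchange of $t_j$ and $t_{j+1}$ adds to the coordinate at $S$ a multiple of the one at $S'$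
(\<open>schur_quot_swap\<close>), and $\hat r_j$ is made to cancel exactly this correction. What remains is
the action of $s_j$ on the roots in $y_\alpha$, which it permutes (\<open>s_B_bethe_root\<close>); the order
does not matter because factorial Schur functions are symmetric.\<close>

section \<open>Exchange operators and the Coxeter relations\<close>

text \<open>This is $s (1 - c\, \sigma_a^+ \sigma_b^-)$ written on coefficient functions. The ring endomorphism
and the scalar are kept apart from the sites so that $j < N$ and $j = N$, and the three rings of
scalars that occur below, are instances of the same statements.\<close>

definition exchange_op ::
    "('a \<Rightarrow> 'a) \<Rightarrow> 'a \<Rightarrow> nat \<Rightarrow> nat \<Rightarrow> 'a::comm_ring_1 operator" where
  "exchange_op s c a b v =
     (\<lambda>S. s (v S - (if a \<in> S \<and> b \<notin> S then c * v (insert b (S - {a})) else 0)))"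

lemma affine_op_eq_exchange_op:
  assumes "cyc_succ N j \<noteq> j"
  shows "affine_op N act t qinv j =
    exchange_op (act j) ((if j = N then qinv else 1) * (t j - t (cyc_succ N j))) j (cyc_succ N j)"
  using assms
  by (auto simp: fun_eq_iff affine_op_def exchange_op_def braid_op_def op_add_def op_scale_def
      vec_add_def vec_scale_def sigma_plus_def sigma_minus_def)

text \<open>The exchange can contribute only once, because its result is a set to which it does not apply; the
two contributions of first order cancel by $s(c) = -c$.\<close>

lemma exchange_op_involution:
  assumes "comm_ring_hom s" "a \<noteq> b" "\<And>x. s (s x) = x" "s c = - c"
  shows "exchange_op s c a b (exchange_op s c a b v) = v"
proof
  fix S
  interpret comm_ring_hom s by fact
  have "a \<in> S \<Longrightarrow> insert a (insert b (S - {a}) - {b}) = S" if "b \<notin> S" using that by blast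
  then show "exchange_op s c a b (exchange_op s c a b v) S = v S"
    using assms by (auto simp: exchange_op_def hom_distribs)
qed

lemma exchange_op_far_commute:
  assumes "comm_ring_hom s" "comm_ring_hom u"
    and "distinct [a, b, d, e]"
    and com: "\<And>x. s (u x) = u (s x)" and fx: "s k = k" "u c = c"
  shows "exchange_op s c a b (exchange_op u k d e v) = exchange_op u k d e (exchange_op s c a b v)"
proof
  fix S
  interpret s: comm_ring_hom s by fact
  interpret u: comm_ring_hom u by fact
  have ne: "a \<noteq> b" "d \<noteq> e" "a \<noteq> d" "a \<noteq> e" "b \<noteq> d" "b \<noteq> e" using assms(3) by auto
  have 1: "insert e (insert b (S - {a}) - {d}) = insert b (insert e (S - {d}) - {a})"
    using ne by auto
  have sc: "u (s c) = s c" "s (u k) = u k" using com[of c] com[of k] fx by simp_all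
  have 2: "s (c * u (k * x)) = u (k * s (c * x))" for x
    by (simp add: s.hom_mult u.hom_mult com fx sc mult.left_commute)
  show "exchange_op s c a b (exchange_op u k d e v) S =
      exchange_op u k d e (exchange_op s c a b v) S"
    using ne by (cases "a \<in> S"; cases "b \<in> S"; cases "d \<in> S"; cases "e \<in> S")
     (simp_all add: exchange_op_def 1 s.hom_add s.hom_mult s.hom_minus u.hom_mult u.hom_minus
       right_diff_distrib com fx sc mult.left_commute)
qed

text \<open>With $e = \sigma_a^+\sigma_b^-$ and $f = \sigma_b^+\sigma_d^-$ one has $e^2 = f^2 = efe = fef = 0$, so
both sides of the Yang--Baxter equation for $1 - c\,e$ and $1 - k f$ are quadratic and agree once
the middle parameter is the sum $c + k$ of the outer ones, which is what $s(k) = u(c) = c + k$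
says. The invariant scalars \<open>g\<close> and \<open>h\<close> rescale $e$ and $f$; one of them is $q^{-1}$ when the
braid passes through the site $N$.\<close>

lemma exchange_op_braid:
  assumes "comm_ring_hom s" "comm_ring_hom u"
    and "distinct [a, b, d]"
    and "\<And>x. s (u (s x)) = u (s (u x))"
    and "s g = g" "u g = g" "s h = h" "u h = h"
    and "s c = - c" "u k = - k" "s k = c + k" "u c = c + k"
  shows "exchange_op s (g * c) a b (exchange_op u (h * k) b d (exchange_op s (g * c) a b v)) =
    exchange_op u (h * k) b d (exchange_op s (g * c) a b (exchange_op u (h * k) b d v))"
proof
  fix S
  interpret s: comm_ring_hom s by fact
  interpret u: comm_ring_hom u by fact
  \<comment> \<open>Only the occupation of the three sites changes, so S is described by its part R elsewhere.\<close>
  define R where "R = S - {a, b, d}"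
  have R: "a \<notin> R" "b \<notin> R" "d \<notin> R" by (auto simp: R_def)
  have ne: "a \<noteq> b" "b \<noteq> a" "a \<noteq> d" "d \<noteq> a" "b \<noteq> d" "d \<noteq> b" using assms(3) by auto
  consider (none) "S = R" | "S = insert a R" | "S = insert b R" | "S = insert d R"
    | "S = insert a (insert b R)" | "S = insert a (insert d R)" | "S = insert b (insert d R)"
    | "S = insert a (insert b (insert d R))"
  proof -
    have "S = R \<union> (S \<inter> {a, b, d})" by (auto simp: R_def)
    moreover have "S \<inter> {a, b, d} \<in> Pow {a, b, d}" by blast
    ultimately show ?thesis
      using that by (cases "a \<in> S"; cases "b \<in> S"; cases "d \<in> S"; force)
  qed
  note split = this
  note com = insert_commute[of d a] insert_commute[of d b] insert_commute[of b a]
  note calc = exchange_op_def R ne insert_Diff_if com s.hom_add s.hom_mult s.hom_uminus s.hom_minus s.hom_zero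
      u.hom_add u.hom_mult u.hom_uminus u.hom_minus u.hom_zero assms(4-)
  show "exchange_op s (g * c) a b (exchange_op u (h * k) b d (exchange_op s (g * c) a b v)) S =
    exchange_op u (h * k) b d (exchange_op s (g * c) a b (exchange_op u (h * k) b d v)) S"
    by (cases rule: split; simp add: calc algebra_simps)
qed


section \<open>Operators that commute\<close>

text \<open>The operator $s \hat r$ is semilinear over $s$, the entries of the $L$-matrices are linear. Treating
both at once, with \<open>s = id\<close> for the latter, gives the commutation of $s\hat r$ with distant
$L$-matrices and that of $L$-matrices at different sites from the same lemmas.\<close>

definition semilinear_op :: "('a \<Rightarrow> 'a) \<Rightarrow> 'a::comm_ring_1 operator \<Rightarrow> bool" where
  "semilinear_op s F \<longleftrightarrow>
     (\<forall>v w. F (vec_add v w) = vec_add (F v) (F w)) \<and>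
     (\<forall>c v. F (vec_scale c v) = vec_scale (s c) (F v))"

definition op_commute :: "'a operator \<Rightarrow> 'a operator \<Rightarrow> bool" where
  "op_commute F G \<longleftrightarrow> (\<forall>v. F (G v) = G (F v))"

definition entrywise :: "('a operator \<Rightarrow> bool) \<Rightarrow> 'a op_mat \<Rightarrow> bool" where
  "entrywise Q X \<longleftrightarrow> Q (entry_A X) \<and> Q (entry_B X) \<and> Q (entry_C X) \<and> Q (entry_D X)"

abbreviation linear_op :: "'a::comm_ring_1 operator \<Rightarrow> bool" where
  "linear_op \<equiv> semilinear_op id"

lemma op_commute_sym: "op_commute F G \<Longrightarrow> op_commute G F"
  by (simp add: op_commute_def)

lemma op_commute_id: "op_commute F id" "op_commute id F"
  by (simp_all add: op_commute_def)

lemma op_commute_comp: "op_commute F G \<Longrightarrow> op_commute F H \<Longrightarrow> op_commute F (G \<circ> H)"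
  by (simp add: op_commute_def)

lemma op_commute_add:
  "semilinear_op s F \<Longrightarrow> op_commute F G \<Longrightarrow> op_commute F H \<Longrightarrow> op_commute F (op_add G H)"
  by (simp add: op_commute_def semilinear_op_def op_add_def)

lemma op_commute_scale:
  "semilinear_op s F \<Longrightarrow> s c = c \<Longrightarrow> op_commute F G \<Longrightarrow> op_commute F (op_scale c G)"
  by (simp add: op_commute_def semilinear_op_def op_scale_def)

lemma op_commute_zero: "semilinear_op s F \<Longrightarrow> op_commute F (\<lambda>v S. 0)"
proof -
  assume F: "semilinear_op s F"
  have "F (vec_add (\<lambda>S. 0) (\<lambda>S. 0)) = vec_add (F (\<lambda>S. 0)) (F (\<lambda>S. 0))"
    using F by (simp add: semilinear_op_def)
  then have "F (\<lambda>S. 0) = (\<lambda>S. 0)" by (simp add: vec_add_def fun_eq_iff)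
  then show ?thesis by (simp add: op_commute_def)
qed

lemma linear_id: "linear_op id"
  by (simp add: semilinear_op_def)

lemma linear_add: "linear_op F \<Longrightarrow> linear_op G \<Longrightarrow> linear_op (op_add F G)"
  by (simp add: semilinear_op_def op_add_def vec_add_def vec_scale_def fun_eq_iff algebra_simps)

lemma linear_scale: "linear_op F \<Longrightarrow> linear_op (op_scale c F)"
  by (simp add: semilinear_op_def op_scale_def vec_add_def vec_scale_def fun_eq_iff algebra_simps)

lemma linear_comp: "linear_op F \<Longrightarrow> linear_op G \<Longrightarrow> linear_op (F \<circ> G)"
  by (simp add: semilinear_op_def)

lemma linear_zero: "linear_op (\<lambda>v S. 0)"
  by (simp add: semilinear_op_def vec_add_def vec_scale_def)

lemma linear_sigma: "linear_op (sigma_plus j)" "linear_op (sigma_minus j)"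
  by (auto simp: semilinear_op_def sigma_plus_def sigma_minus_def vec_add_def vec_scale_def)

lemma linear_lax: "entrywise linear_op (lax t x j)"
  by (simp add: entrywise_def lax_def linear_id linear_add linear_scale linear_comp linear_sigma)

lemma linear_lax': "entrywise linear_op (lax' t x j)"
  by (simp add: entrywise_def lax'_def linear_id linear_add linear_scale linear_comp linear_sigma)

lemma linear_op_mat_one: "entrywise linear_op op_mat_one"
  by (simp add: entrywise_def op_mat_one_def linear_id linear_zero)

lemma linear_op_mat_mult:
  "entrywise linear_op X \<Longrightarrow> entrywise linear_op Y \<Longrightarrow> entrywise linear_op (op_mat_mult X Y)"
  by (simp add: entrywise_def op_mat_mult_def linear_add linear_comp)

lemma linear_op_mat_prod:
  "(\<And>i. entrywise linear_op (L i)) \<Longrightarrow> entrywise linear_op (op_mat_prod L m)"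
  by (induction m) (simp_all add: linear_op_mat_one linear_op_mat_mult)

lemma op_commute_op_mat_one: "semilinear_op s F \<Longrightarrow> entrywise (op_commute F) op_mat_one"
  by (simp add: entrywise_def op_mat_one_def op_commute_id op_commute_zero)

lemma op_commute_op_mat_mult:
  assumes "semilinear_op s F" "entrywise (op_commute F) X" "entrywise (op_commute F) Y"
  shows "entrywise (op_commute F) (op_mat_mult X Y)"
  using assms by (auto simp: entrywise_def op_mat_mult_def intro!: op_commute_add op_commute_comp)

lemma op_commute_op_mat_prod:
  assumes "semilinear_op s F" "\<And>i. i \<in> {1..m} \<Longrightarrow> entrywise (op_commute F) (L i)"
  shows "entrywise (op_commute F) (op_mat_prod L m)"
  using assms(2)
  by (induction m) (auto intro: op_commute_op_mat_one op_commute_op_mat_mult assms(1))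

lemma op_mat_mult_one_left:
  fixes X :: "'a::comm_ring_1 op_mat"
  shows "op_mat_mult op_mat_one X = X"
  by (cases X) (simp add: op_mat_mult_def op_mat_one_def op_add_def vec_add_def)

lemma op_mat_mult_one_right:
  assumes "entrywise linear_op X"
  shows "op_mat_mult X op_mat_one = X"
proof -
  have "F (\<lambda>S. 0) = (\<lambda>S. 0)" if "linear_op F" for F :: "'a operator"
    using op_commute_zero[OF that] by (simp add: op_commute_def)
  then show ?thesis using assms
    by (cases X) (auto simp: op_mat_mult_def op_mat_one_def op_add_def vec_add_def entrywise_def fun_eq_iff)
qed

text \<open>Entries are arbitrary functions on vectors; distributivity holds on the right for all of them but
on the left only for additive ones.\<close>

lemma op_mat_mult_assoc:
  assumes "entrywise linear_op X"
  shows "op_mat_mult (op_mat_mult X Y) Z = op_mat_mult X (op_mat_mult Y Z)"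
  using assms
  by (simp add: op_mat_mult_def entrywise_def semilinear_op_def op_add_def vec_add_def fun_eq_iff
      algebra_simps)

lemma op_mat_prod_split_first:
  assumes "\<And>i. entrywise linear_op (L i)"
  shows "op_mat_prod L (Suc m) = op_mat_mult (op_mat_prod (\<lambda>i. L (Suc i)) m) (L 1)"
proof (induction m)
  case 0
  then show ?case
    using op_mat_mult_one_right[OF assms] by (simp add: op_mat_mult_one_left)
next
  case (Suc m)
  then show ?case using op_mat_mult_assoc[OF assms] by simp
qed

section \<open>Commutation with monodromy and transfer matrices\<close>

lemma semilinear_exchange_op:
  assumes "comm_ring_hom s"
  shows "semilinear_op s (exchange_op s c a b)"
proof -
  interpret comm_ring_hom s by fact
  show ?thesis
    by (auto simp: semilinear_op_def exchange_op_def vec_add_def vec_scale_def hom_add hom_mult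
        hom_minus algebra_simps)
qed

lemma op_commute_exchange_op_sigma:
  assumes "comm_ring_hom s" "i \<noteq> a" "i \<noteq> b"
  shows "op_commute (exchange_op s c a b) (sigma_plus i)"
    and "op_commute (exchange_op s c a b) (sigma_minus i)"
proof -
  interpret comm_ring_hom s by fact
  have "insert b (S - {a}) - {i} = insert b (S - {i} - {a})"
    "insert i (insert b (S - {a})) = insert b (insert i S - {a})" for S
    using assms by auto
  with assms show "op_commute (exchange_op s c a b) (sigma_plus i)"
    "op_commute (exchange_op s c a b) (sigma_minus i)"
    by (auto simp: op_commute_def exchange_op_def sigma_plus_def sigma_minus_def fun_eq_iff)
qed

lemma op_commute_sigma:
  assumes "i \<noteq> j"
  shows "op_commute (sigma_plus i) (sigma_plus j)" "op_commute (sigma_minus i) (sigma_minus j)"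
    "op_commute (sigma_plus i) (sigma_minus j)" "op_commute (sigma_minus i) (sigma_plus j)"
  using assms
  by (auto simp: op_commute_def sigma_plus_def sigma_minus_def fun_eq_iff insert_commute
      insert_Diff_if Diff_insert[symmetric])

lemma op_commute_lax:
  assumes "semilinear_op s F" "op_commute F (sigma_plus i)" "op_commute F (sigma_minus i)"
    and "s x = x" "s (x * t i) = x * t i" "s (- (x * t i)) = - (x * t i)"
  shows "entrywise (op_commute F) (lax t x i)" "entrywise (op_commute F) (lax' t x i)"
  using assms
  by (auto simp: entrywise_def lax_def lax'_def op_commute_id
      intro!: op_commute_add op_commute_scale op_commute_comp)

text \<open>The product $\mathrm{diag}(1, k)\, X$.\<close>

definition twist :: "'a \<Rightarrow> 'a::comm_ring_1 op_mat \<Rightarrow> 'a op_mat" where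
  "twist k X = Op_Mat (entry_A X) (entry_B X) (op_scale k (entry_C X)) (op_scale k (entry_D X))"

lemma two_site_cases:
  obtains R where "a \<notin> R" "b \<notin> R"
    "S = R \<or> S = insert a R \<or> S = insert b R \<or> S = insert a (insert b R)"
proof
  show "a \<notin> S - {a, b}" "b \<notin> S - {a, b}" by auto
  show "S = S - {a, b} \<or> S = insert a (S - {a, b}) \<or> S = insert b (S - {a, b}) \<or>
    S = insert a (insert b (S - {a, b}))"
    by (cases "a \<in> S"; cases "b \<in> S"; force)
qed

text \<open>The exchange relation $\hat r\, L_b L_a = (L_b L_a)' \hat r$, in which the prime exchanges $t_a$ and
$t_b$. With $k = g = 1$ it handles neighbours $a = j$, $b = j + 1$. With $k = q$, $g = q^{-1}$ it
handles $a = N$, $b = 1$: the twist between the factors gives the weight $q$ to the term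
$\sigma_b^+\sigma_a^-$ of the product, and $\sigma_a^+\sigma_b^-$ moves the particle back with the weight
$q^{-1}$.\<close>

lemma exchange_op_commute_two_lax:
  assumes "comm_ring_hom s" "a \<noteq> b"
    and "s (t a) = t b" "s (t b) = t a" "s x = x" "s g = g" "s k = k" "g * k = 1"
  shows "entrywise (op_commute (exchange_op s (g * (t a - t b)) a b))
      (op_mat_mult (lax t x b) (twist k (lax t x a)))"
    and "entrywise (op_commute (exchange_op s (g * (t a - t b)) a b))
      (op_mat_mult (lax' t x b) (twist k (lax' t x a)))"
proof -
  interpret comm_ring_hom s by fact
  note ops = exchange_op_def op_mat_mult_def lax_def lax'_def twist_def op_add_def op_scale_def
    vec_add_def vec_scale_def sigma_plus_def sigma_minus_def
  have gk: "g * (k * y) = y" for y using assms(8) by (simp flip: mult.assoc)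
  have ba: "b \<noteq> a" using assms(2) by simp
  have com: "insert b (insert a R) = insert a (insert b R)" for R by blast
  note calc = ops assms(2-8) ba com insert_Diff_if hom_add hom_mult hom_minus hom_uminus
  show "entrywise (op_commute (exchange_op s (g * (t a - t b)) a b))
      (op_mat_mult (lax t x b) (twist k (lax t x a)))"
    unfolding entrywise_def op_commute_def
  proof (intro conjI allI ext)
    fix v S
    obtain R where R: "a \<notin> R" "b \<notin> R"
      "S = R \<or> S = insert a R \<or> S = insert b R \<or> S = insert a (insert b R)"
      by (rule two_site_cases)
    let ?P = "exchange_op s (g * (t a - t b)) a b"
    let ?M = "op_mat_mult (lax t x b) (twist k (lax t x a))"
    show "?P (entry_A ?M v) S = entry_A ?M (?P v) S" "?P (entry_B ?M v) S = entry_B ?M (?P v) S"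
      "?P (entry_C ?M v) S = entry_C ?M (?P v) S" "?P (entry_D ?M v) S = entry_D ?M (?P v) S"
      using R(3) by (elim disjE; simp add: calc R algebra_simps gk)+
  qed
  show "entrywise (op_commute (exchange_op s (g * (t a - t b)) a b))
      (op_mat_mult (lax' t x b) (twist k (lax' t x a)))"
    unfolding entrywise_def op_commute_def
  proof (intro conjI allI ext)
    fix v S
    obtain R where R: "a \<notin> R" "b \<notin> R"
      "S = R \<or> S = insert a R \<or> S = insert b R \<or> S = insert a (insert b R)"
      by (rule two_site_cases)
    let ?P = "exchange_op s (g * (t a - t b)) a b"
    let ?M = "op_mat_mult (lax' t x b) (twist k (lax' t x a))"
    show "?P (entry_A ?M v) S = entry_A ?M (?P v) S" "?P (entry_B ?M v) S = entry_B ?M (?P v) S"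
      "?P (entry_C ?M v) S = entry_C ?M (?P v) S" "?P (entry_D ?M v) S = entry_D ?M (?P v) S"
      using R(3) by (elim disjE; simp add: calc R algebra_simps gk)+
  qed
qed



text \<open>The two factors affected by the exchange commute with it only as a pair, so the induction starts
at the product that ends with this pair.\<close>

lemma op_commute_op_mat_prod_adjacent:
  assumes F: "semilinear_op s F"
    and lin: "\<And>i. entrywise linear_op (L i)"
    and far: "\<And>i. i \<in> {1..N} \<Longrightarrow> i \<noteq> j \<Longrightarrow> i \<noteq> Suc j \<Longrightarrow> entrywise (op_commute F) (L i)"
    and near: "entrywise (op_commute F) (op_mat_mult (L (Suc j)) (L j))"
    and "1 \<le> j" "Suc j \<le> m" "m \<le> N"
  shows "entrywise (op_commute F) (op_mat_prod L m)"
  using assms(6,7)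
proof (induction m rule: dec_induct)
  case base
  obtain i where i: "j = Suc i" using assms(5) by (cases j) auto
  have "entrywise (op_commute F) (op_mat_prod L i)"
    using base i by (intro op_commute_op_mat_prod[OF F] far) auto
  then have "entrywise (op_commute F) (op_mat_mult (op_mat_mult (L (Suc j)) (L j)) (op_mat_prod L i))"
    by (rule op_commute_op_mat_mult[OF F near])
  then show ?case using i by (simp add: op_mat_mult_assoc[OF lin])
next
  case (step m)
  then show ?case by (auto intro!: op_commute_op_mat_mult[OF F] far)
qed

text \<open>The trace of $\mathrm{diag}(1,q) X K Y$ is that of $K Y\, \mathrm{diag}(1,q) X$. Cyclicity of the
trace moves the matrix entries; the order of the operators is then restored because the entries
of $X$ commute with those of $K$ and $Y$.\<close>

lemma twisted_trace_cyclic: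
  fixes X K Y :: "'a::comm_ring_1 op_mat" and q :: 'a
  assumes lin: "entrywise linear_op X" "entrywise linear_op K" "entrywise linear_op Y"
    and XK: "entrywise (\<lambda>F. entrywise (op_commute F) K) X"
    and XY: "entrywise (\<lambda>F. entrywise (op_commute F) Y) X"
  defines "M \<equiv> op_mat_mult X (op_mat_mult K Y)"
    and "Z \<equiv> op_mat_mult Y (twist q X)"
  shows "op_add (entry_A M) (op_scale q (entry_D M)) =
    op_add (op_add (entry_A K \<circ> entry_A Z) (entry_B K \<circ> entry_C Z))
           (op_add (entry_C K \<circ> entry_B Z) (entry_D K \<circ> entry_D Z))"
proof -
  have assoc: "vec_add (vec_add u v) w = vec_add u (vec_add v w)"
    "vec_add u v = vec_add v u" "vec_add u (vec_add v w) = vec_add v (vec_add u w)"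
    "vec_scale q (vec_add v w) = vec_add (vec_scale q v) (vec_scale q w)"
    for u v w :: "'a vec"
    by (simp_all add: vec_add_def vec_scale_def algebra_simps)
  show ?thesis
    using assms(1-5)
    by (simp add: M_def Z_def op_mat_mult_def twist_def op_add_def op_scale_def entrywise_def
        semilinear_op_def op_commute_def fun_eq_iff[of "\<lambda>v. vec_add (_ v) (_ v)"] assoc)
qed

text \<open>Here $F$ exchanges the sites $N$ and $1$, so in $L_N \cdots L_1$ it is the outermost factors that it
does not commute with.\<close>

lemma op_commute_twisted_trace:
  fixes L :: "nat \<Rightarrow> 'a::comm_ring_1 op_mat" and q :: 'a
  assumes F: "semilinear_op s F"
    and lin: "\<And>i. entrywise linear_op (L i)"
    and sites: "\<And>i j. i \<noteq> j \<Longrightarrow> entrywise (\<lambda>G. entrywise (op_commute G) (L j)) (L i)"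
    and far: "\<And>i. 1 < i \<Longrightarrow> i < N \<Longrightarrow> entrywise (op_commute F) (L i)"
    and near: "entrywise (op_commute F) (op_mat_mult (L 1) (twist q (L N)))"
    and "N \<ge> 2"
  shows "op_commute F (op_add (entry_A (op_mat_prod L N)) (op_scale q (entry_D (op_mat_prod L N))))"
proof -
  obtain m where N: "N = Suc (Suc m)" using \<open>N \<ge> 2\<close> by (metis Suc_le_D numeral_2_eq_2 Suc_le_mono)
  define K where "K = op_mat_prod (\<lambda>i. L (Suc i)) m"
  have M: "op_mat_prod L N = op_mat_mult (L N) (op_mat_mult K (L 1))"
    using op_mat_prod_split_first[of L m, OF lin] by (simp add: N K_def)
  have linK: "entrywise linear_op K"
    unfolding K_def by (rule linear_op_mat_prod) (rule lin)
  have "entrywise (op_commute G) K" if "G \<in> {entry_A (L N), entry_B (L N), entry_C (L N), entry_D (L N)}" for G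
  proof -
    have "semilinear_op id G" using that lin[of N] by (auto simp: entrywise_def)
    then show ?thesis
      unfolding K_def
    proof (rule op_commute_op_mat_prod)
      fix i assume "i \<in> {1..m}"
      then have "N \<noteq> Suc i" using N by auto
      from sites[OF this] show "entrywise (op_commute G) (L (Suc i))"
        using that by (auto simp: entrywise_def)
    qed
  qed
  then have XK: "entrywise (\<lambda>G. entrywise (op_commute G) K) (L N)"
    unfolding entrywise_def[of _ "L N"] by blast
  have FK: "entrywise (op_commute F) K"
    unfolding K_def using N by (intro op_commute_op_mat_prod[OF F] far) auto
  have "op_commute F (op_add (op_add (entry_A K \<circ> entry_A Z) (entry_B K \<circ> entry_C Z))
           (op_add (entry_C K \<circ> entry_B Z) (entry_D K \<circ> entry_D Z)))"
    if "entrywise (op_commute F) Z" for Z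
    using that FK by (auto simp: entrywise_def intro!: op_commute_add[OF F] op_commute_comp)
  moreover have "N \<noteq> 1" using N by simp
  ultimately show ?thesis
    unfolding M using twisted_trace_cyclic[OF lin linK lin XK sites[OF \<open>N \<noteq> 1\<close>], of q] near by simp
qed

lemma lax_sites_commute:
  assumes "i \<noteq> j"
  shows "entrywise (\<lambda>G. entrywise (op_commute G) (lax t x j)) (lax t x i)"
    and "entrywise (\<lambda>G. entrywise (op_commute G) (lax' t x j)) (lax' t x i)"
proof -
  have "entrywise (op_commute (sigma_plus j)) (lax t x i)"
    "entrywise (op_commute (sigma_plus j)) (lax' t x i)"
    "entrywise (op_commute (sigma_minus j)) (lax t x i)"
    "entrywise (op_commute (sigma_minus j)) (lax' t x i)"
    using assms
    by (intro op_commute_lax[OF linear_sigma(1)] op_commute_lax[OF linear_sigma(2)] op_commute_sigma;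
        simp)+
  then have sigma: "entrywise (\<lambda>G. op_commute G (sigma_plus j) \<and> op_commute G (sigma_minus j)) (lax t x i)"
    "entrywise (\<lambda>G. op_commute G (sigma_plus j) \<and> op_commute G (sigma_minus j)) (lax' t x i)"
    by (auto simp: entrywise_def intro: op_commute_sym)
  have "entrywise (op_commute G) (lax t x j)" "entrywise (op_commute G) (lax' t x j)"
    if "linear_op G" "op_commute G (sigma_plus j)" "op_commute G (sigma_minus j)" for G
    using op_commute_lax[OF that, of x t] by simp_all
  then show "entrywise (\<lambda>G. entrywise (op_commute G) (lax t x j)) (lax t x i)"
    and "entrywise (\<lambda>G. entrywise (op_commute G) (lax' t x j)) (lax' t x i)"
    using sigma linear_lax[of t x i] linear_lax'[of t x i] unfolding entrywise_def by blast+
qed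

lemma op_commute_exchange_op_lax:
  assumes "comm_ring_hom s" "i \<noteq> a" "i \<noteq> b" "s x = x" "s (t i) = t i"
  shows "entrywise (op_commute (exchange_op s c a b)) (lax t x i)"
    and "entrywise (op_commute (exchange_op s c a b)) (lax' t x i)"
proof -
  interpret comm_ring_hom s by fact
  note op_commute_lax[OF semilinear_exchange_op[OF assms(1)] op_commute_exchange_op_sigma[OF assms(1-3)]]
  then show "entrywise (op_commute (exchange_op s c a b)) (lax t x i)"
    and "entrywise (op_commute (exchange_op s c a b)) (lax' t x i)"
    using assms by (auto simp: hom_mult hom_uminus)
qed

lemma twist_1: "twist 1 X = X"
  by (cases X) (simp add: twist_def op_scale_def vec_scale_def)

theorem affine_op_commute_monodromy:
  assumes s: "comm_ring_hom (act j)" and j: "1 \<le> j" "j < N"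
    and t: "\<And>i. i \<in> {1..N} \<Longrightarrow> act j (t i) = t (transpose j (Suc j) i)" and x: "act j x = x"
  shows "entrywise (op_commute (affine_op N act t qinv j)) (monodromy N t x)"
    and "entrywise (op_commute (affine_op N act t qinv j)) (monodromy' N t x)"
proof -
  have eq: "affine_op N act t qinv j = exchange_op (act j) (1 * (t j - t (Suc j))) j (Suc j)"
    using j by (subst affine_op_eq_exchange_op) (auto simp: cyc_succ_def)
  interpret comm_ring_hom "act j" by fact
  have near: "entrywise (op_commute (affine_op N act t qinv j)) (op_mat_mult (lax t x (Suc j)) (lax t x j))"
    "entrywise (op_commute (affine_op N act t qinv j)) (op_mat_mult (lax' t x (Suc j)) (lax' t x j))"
    using exchange_op_commute_two_lax[of "act j" j "Suc j" t x 1 1] s j t x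
    by (auto simp: eq twist_1)
  have far: "entrywise (op_commute (affine_op N act t qinv j)) (lax t x i)"
    "entrywise (op_commute (affine_op N act t qinv j)) (lax' t x i)"
    if "i \<in> {1..N}" "i \<noteq> j" "i \<noteq> Suc j" for i
    unfolding eq using that t[of i] op_commute_exchange_op_lax[OF s, of i j "Suc j"] x by auto
  have F: "semilinear_op (act j) (affine_op N act t qinv j)"
    unfolding eq by (rule semilinear_exchange_op[OF s])
  show "entrywise (op_commute (affine_op N act t qinv j)) (monodromy N t x)"
    unfolding monodromy_def using j
    by (intro op_commute_op_mat_prod_adjacent[OF F linear_lax far(1) near(1)]) auto
  show "entrywise (op_commute (affine_op N act t qinv j)) (monodromy' N t x)"
    unfolding monodromy'_def using j
    by (intro op_commute_op_mat_prod_adjacent[OF F linear_lax' far(2) near(2)]) auto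
qed

theorem affine_op_commute_transfer:
  assumes s: "comm_ring_hom (act j)" and N: "N \<ge> 2" and j: "j \<in> {1..N}"
    and t: "\<And>i. i \<in> {1..N} \<Longrightarrow> act j (t i) = t (transpose j (cyc_succ N j) i)" and x: "act j x = x"
    and q: "act j q = q" "act j qinv = qinv" "qinv * q = 1"
  shows "op_commute (affine_op N act t qinv j) (transfer_H N t q x)"
    and "op_commute (affine_op N act t qinv j) (transfer_E N t q x)"
proof -
  have succ: "cyc_succ N j \<noteq> j" using N by (auto simp: cyc_succ_def)
  have F: "semilinear_op (act j) (affine_op N act t qinv j)"
    unfolding affine_op_eq_exchange_op[OF succ] by (rule semilinear_exchange_op[OF s])
  have "op_commute (affine_op N act t qinv j) (transfer_H N t q x) \<and>
    op_commute (affine_op N act t qinv j) (transfer_E N t q x)"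
  proof (cases "j = N")
    case False
    then have "j < N" "1 \<le> j" using j by auto
    then have "entrywise (op_commute (affine_op N act t qinv j)) (monodromy N t x)"
      "entrywise (op_commute (affine_op N act t qinv j)) (monodromy' N t x)"
      using affine_op_commute_monodromy[where act = act and j = j and N = N, OF s] t x
      by (auto simp: cyc_succ_def)
    then show ?thesis
      unfolding transfer_H_def transfer_E_def
      by (auto simp: entrywise_def q(1) intro!: op_commute_add[OF F] op_commute_scale[OF F])
  next
    case True
    have eq: "affine_op N act t qinv j = exchange_op (act j) (qinv * (t N - t 1)) N 1"
      using True by (subst affine_op_eq_exchange_op[OF succ]) (simp add: cyc_succ_def)
    have near: "entrywise (op_commute (affine_op N act t qinv j)) (op_mat_mult (lax t x 1) (twist q (lax t x N)))"
      "entrywise (op_commute (affine_op N act t qinv j)) (op_mat_mult (lax' t x 1) (twist q (lax' t x N)))"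
      using exchange_op_commute_two_lax[OF s, of N 1 t x qinv q] N t[of 1] t[of N] x q
      unfolding eq by (auto simp: True cyc_succ_def)
    have far: "entrywise (op_commute (affine_op N act t qinv j)) (lax t x i)"
      "entrywise (op_commute (affine_op N act t qinv j)) (lax' t x i)"
      if "1 < i" "i < N" for i
      unfolding eq using that True t[of i] op_commute_exchange_op_lax[OF s, of i N 1] x
      by (auto simp: cyc_succ_def)
    show ?thesis
      unfolding transfer_H_def transfer_E_def monodromy_def monodromy'_def
      using op_commute_twisted_trace[OF F linear_lax lax_sites_commute(1) far(1) near(1) N]
        op_commute_twisted_trace[OF F linear_lax' lax_sites_commute(2) far(2) near(2) N]
      by blast
  qed
  then show "op_commute (affine_op N act t qinv j) (transfer_H N t q x)"
    and "op_commute (affine_op N act t qinv j) (transfer_E N t q x)" by auto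
qed

section \<open>The symmetric group on the scalars\<close>

lemma poly_mapping_add_induct [case_names zero add]:
  fixes p :: "'k \<Rightarrow>\<^sub>0 'b::monoid_add"
  assumes "P 0" "\<And>p k c. P p \<Longrightarrow> P (p + Poly_Mapping.single k c)"
  shows "P p"
proof (induction p rule: update_induct)
  case const
  show ?case by fact
next
  case (update p k c)
  have "Poly_Mapping.update k c p = p + Poly_Mapping.single k c"
    using update(1) by (intro poly_mapping_eqI)
      (auto simp: lookup_update lookup_add lookup_single when_def in_keys_iff)
  then show ?case using assms(2)[OF update(3)] by simp
qed

text \<open>Multiplication is biadditive, so multiplicativity may be tested on monomials. This is used both for
polynomials in the $T_i$ and for Laurent polynomials in $q$ over them.\<close>

lemma comm_ring_hom_poly_mappingI:
  fixes F :: "('k::comm_monoid_add \<Rightarrow>\<^sub>0 'b::comm_ring_1) \<Rightarrow> 'c::comm_ring_1"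
  assumes add: "\<And>p q. F (p + q) = F p + F q" and one: "F 1 = 1"
    and single: "\<And>k l a b. F (Poly_Mapping.single k a * Poly_Mapping.single l b) =
      F (Poly_Mapping.single k a) * F (Poly_Mapping.single l b)"
  shows "comm_ring_hom F"
proof -
  have zero: "F 0 = 0" using add[of 0 0] by simp
  have "F (Poly_Mapping.single k a * q) = F (Poly_Mapping.single k a) * F q" for k a q
    by (induction q rule: poly_mapping_add_induct) (simp_all add: zero add single distrib_left)
  then have "F (p * q) = F p * F q" for p q
    by (induction p rule: poly_mapping_add_induct) (simp_all add: zero add distrib_right)
  then show ?thesis by unfold_locales (simp_all add: add one zero)
qed

lemma inj_transpose: "inj (transpose a b)"
  by (rule injI) (metis transpose_involutory)

lemma lookup_map_key: "inj f \<Longrightarrow> Poly_Mapping.lookup (Poly_Mapping.map_key f p) k = Poly_Mapping.lookup p (f k)"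
  by (simp add: map_key.rep_eq)

lemma map_key_transpose_involution:
  "Poly_Mapping.map_key (transpose a b) (Poly_Mapping.map_key (transpose a b) m) = m"
  by (rule poly_mapping_eqI) (simp add: lookup_map_key inj_transpose)

lemma inj_map_key_transpose: "inj (Poly_Mapping.map_key (transpose a b))"
  by (rule injI) (metis map_key_transpose_involution)

lemma lookup_swap_vars:
  "Poly_Mapping.lookup (swap_vars a b p) m = Poly_Mapping.lookup p (Poly_Mapping.map_key (transpose a b) m)"
  by (simp add: swap_vars_def lookup_map_key inj_map_key_transpose)

lemma swap_vars_single:
  "swap_vars a b (Poly_Mapping.single m c) =
    Poly_Mapping.single (Poly_Mapping.map_key (transpose a b) m) c"
  unfolding swap_vars_def
  using map_key_single[OF inj_map_key_transpose, of a b "Poly_Mapping.map_key (transpose a b) m" c]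
  by (simp add: map_key_transpose_involution)

lemma comm_ring_hom_swap_vars: "comm_ring_hom (swap_vars a b :: 'c::comm_ring_1 mpol \<Rightarrow> 'c mpol)"
proof (rule comm_ring_hom_poly_mappingI)
  show "swap_vars a b (p + q) = swap_vars a b p + swap_vars a b q" for p q :: "'c mpol"
    by (simp add: swap_vars_def map_key_plus inj_map_key_transpose)
  show "swap_vars a b (Poly_Mapping.single k c * Poly_Mapping.single l d) =
      swap_vars a b (Poly_Mapping.single k c) * swap_vars a b (Poly_Mapping.single l d)"
    for k l and c d :: 'c
    by (simp add: mult_single swap_vars_single map_key_plus inj_transpose)
  show "swap_vars a b 1 = (1 :: 'c mpol)"
    using swap_vars_single[of a b 0 "1 :: 'c"] by (simp add: inj_transpose)
qed

lemma swap_vars_involution: "swap_vars a b (swap_vars a b p) = p"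
  by (rule poly_mapping_eqI) (simp add: lookup_swap_vars map_key_transpose_involution)

lemma swap_vars_commute:
  assumes "distinct [a, b, d, e]"
  shows "swap_vars a b (swap_vars d e p) = swap_vars d e (swap_vars a b p)"
proof -
  have "Poly_Mapping.map_key (transpose d e) (Poly_Mapping.map_key (transpose a b) m) =
    Poly_Mapping.map_key (transpose a b) (Poly_Mapping.map_key (transpose d e) m)"
    for m :: "nat \<Rightarrow>\<^sub>0 nat"
    using assms
    by (intro poly_mapping_eqI) (auto simp: lookup_map_key inj_transpose transpose_def)
  then show ?thesis by (intro poly_mapping_eqI) (simp add: lookup_swap_vars)
qed

lemma swap_vars_braid:
  assumes "distinct [a, b, d]"
  shows "swap_vars a b (swap_vars b d (swap_vars a b p)) =
    swap_vars b d (swap_vars a b (swap_vars b d p))"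
proof -
  have "Poly_Mapping.map_key (transpose a b) (Poly_Mapping.map_key (transpose b d) (Poly_Mapping.map_key (transpose a b) m)) =
    Poly_Mapping.map_key (transpose b d) (Poly_Mapping.map_key (transpose a b) (Poly_Mapping.map_key (transpose b d) m))"
    for m :: "nat \<Rightarrow>\<^sub>0 nat"
    using assms
    by (intro poly_mapping_eqI) (auto simp: lookup_map_key inj_transpose transpose_def)
  then show ?thesis by (intro poly_mapping_eqI) (simp add: lookup_swap_vars)
qed

lemma swap_vars_T_var: "swap_vars a b (T_var i) = T_var (transpose a b i)"
proof -
  have "Poly_Mapping.map_key (transpose a b) (Poly_Mapping.single i (1::nat)) =
    Poly_Mapping.single (transpose a b i) 1"
    using map_key_single[OF inj_transpose, of a b "transpose a b i" "1::nat"] by simp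
  then show ?thesis by (simp add: T_var_def swap_vars_single)
qed

lemma T_var_inject: "T_var i = (T_var j :: 'c::zero_neq_one mpol) \<longleftrightarrow> i = j"
proof
  assume "T_var i = (T_var j :: 'c mpol)"
  then have "Poly_Mapping.keys (T_var i :: 'c mpol) = Poly_Mapping.keys (T_var j :: 'c mpol)" by simp
  then have "Poly_Mapping.single i (1::nat) = Poly_Mapping.single j 1" by (simp add: T_var_def)
  then have "Poly_Mapping.keys (Poly_Mapping.single i (1::nat)) = Poly_Mapping.keys (Poly_Mapping.single j (1::nat))"
    by simp
  then show "i = j" by simp
qed simp

lemma comm_ring_hom_s_pol: "comm_ring_hom (s_pol N j :: 'c::comm_ring_1 mpol \<Rightarrow> 'c mpol)"
  unfolding s_pol_def by (rule comm_ring_hom_swap_vars)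

lemma s_pol_involution: "s_pol N j (s_pol N j p) = p"
  by (simp add: s_pol_def swap_vars_involution)

lemma cyc_succ_in: "j \<in> {1..N} \<Longrightarrow> cyc_succ N j \<in> {1..N}"
  by (auto simp: cyc_succ_def)

lemma cyc_succ_inj: "i \<in> {1..N} \<Longrightarrow> j \<in> {1..N} \<Longrightarrow> cyc_succ N i = cyc_succ N j \<longleftrightarrow> i = j"
  by (auto simp: cyc_succ_def)

lemma cyc_succ_neq: "N \<ge> 2 \<Longrightarrow> cyc_succ N j \<noteq> j"
  by (auto simp: cyc_succ_def)

lemma reflect_eq_iff:
  "i \<in> {1..N} \<Longrightarrow> j \<in> {1..N} \<Longrightarrow> N + 1 - i = N + 1 - j \<longleftrightarrow> i = (j::nat)"
  by auto

lemma s_pol_T_var: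
  assumes "j \<in> {1..N}" "i \<in> {1..N}"
  shows "s_pol N j (T_var (N + 1 - i)) = T_var (N + 1 - transpose j (cyc_succ N j) i)"
  using assms cyc_succ_in[OF assms(1)] reflect_eq_iff[OF assms]
    reflect_eq_iff[OF assms(2) cyc_succ_in[OF assms(1)]] reflect_eq_iff[OF assms(2,1)]
  by (auto simp: s_pol_def swap_vars_T_var transpose_def)

lemma s_pol_commute:
  assumes "i \<in> {1..N}" "j \<in> {1..N}" "i \<noteq> j" "cyc_succ N i \<noteq> j" "cyc_succ N j \<noteq> i" "N \<ge> 2"
  shows "s_pol N i (s_pol N j p) = s_pol N j (s_pol N i p)"
proof -
  note reflect = reflect_eq_iff[of _ N] cyc_succ_in[OF assms(1)] cyc_succ_in[OF assms(2)]
  have "distinct [N + 1 - i, N + 1 - cyc_succ N i, N + 1 - j, N + 1 - cyc_succ N j]"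
    using assms reflect cyc_succ_inj[OF assms(1,2)] cyc_succ_neq[OF assms(6), of i]
      cyc_succ_neq[OF assms(6), of j]
    by (simp add: reflect del: atLeastAtMost_iff)
  then show ?thesis unfolding s_pol_def by (rule swap_vars_commute)
qed

lemma cyc_succ_distinct:
  "N \<ge> 3 \<Longrightarrow> j \<in> {1..N} \<Longrightarrow> distinct [j, cyc_succ N j, cyc_succ N (cyc_succ N j)]"
  by (auto simp: cyc_succ_def)

lemma s_pol_braid:
  assumes "N \<ge> 3" "j \<in> {1..N}" "i = cyc_succ N j"
  shows "s_pol N j (s_pol N i (s_pol N j p)) = s_pol N i (s_pol N j (s_pol N i p))"
proof -
  have "i \<in> {1..N}" "cyc_succ N i \<in> {1..N}"
    using assms(2) unfolding assms(3) by (blast intro: cyc_succ_in)+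
  then have "distinct [N + 1 - j, N + 1 - i, N + 1 - cyc_succ N i]"
    using cyc_succ_distinct[OF assms(1,2)] assms(2,3) by auto
  then show ?thesis unfolding s_pol_def assms(3)[symmetric] by (rule swap_vars_braid)
qed

lemma lookup_s_L: "Poly_Mapping.lookup (s_L N j p) k = s_pol N j (Poly_Mapping.lookup p k)"
proof -
  interpret comm_ring_hom "s_pol N j :: int mpol \<Rightarrow> int mpol" by (rule comm_ring_hom_s_pol)
  show ?thesis by (simp add: s_L_def map.rep_eq when_def)
qed

lemma s_L_single: "s_L N j (Poly_Mapping.single k c) = Poly_Mapping.single k (s_pol N j c)"
proof -
  interpret comm_ring_hom "s_pol N j :: int mpol \<Rightarrow> int mpol" by (rule comm_ring_hom_s_pol)
  show ?thesis by (simp add: s_L_def)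
qed

lemma comm_ring_hom_s_L: "comm_ring_hom (s_L N j)"
proof -
  interpret comm_ring_hom "s_pol N j :: int mpol \<Rightarrow> int mpol" by (rule comm_ring_hom_s_pol)
  show ?thesis
  proof (rule comm_ring_hom_poly_mappingI)
    show "s_L N j (p + q) = s_L N j p + s_L N j q" for p q
      by (rule poly_mapping_eqI) (simp add: lookup_s_L lookup_add hom_add)
    show "s_L N j 1 = 1"
      using s_L_single[of N j 0 1] by simp
    show "s_L N j (Poly_Mapping.single k a * Poly_Mapping.single l b) =
      s_L N j (Poly_Mapping.single k a) * s_L N j (Poly_Mapping.single l b)" for k l a b
      by (simp add: s_L_single mult_single hom_mult)
  qed
qed

lemma s_L_involution: "s_L N j (s_L N j p) = p"
  by (rule poly_mapping_eqI) (simp add: lookup_s_L s_pol_involution)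

lemma s_L_commute:
  assumes "i \<in> {1..N}" "j \<in> {1..N}" "i \<noteq> j" "cyc_succ N i \<noteq> j" "cyc_succ N j \<noteq> i" "N \<ge> 2"
  shows "s_L N i (s_L N j p) = s_L N j (s_L N i p)"
  by (rule poly_mapping_eqI, unfold lookup_s_L) (rule s_pol_commute[OF assms])

lemma s_L_braid:
  assumes "N \<ge> 3" "j \<in> {1..N}" "i = cyc_succ N j"
  shows "s_L N j (s_L N i (s_L N j p)) = s_L N i (s_L N j (s_L N i p))"
  by (rule poly_mapping_eqI, unfold lookup_s_L) (rule s_pol_braid[OF assms])

lemma s_L_t_L:
  assumes "j \<in> {1..N}" "i \<in> {1..N}"
  shows "s_L N j (t_L N i) = t_L N (transpose j (cyc_succ N j) i)"
  using s_pol_T_var[OF assms, where 'a = int] by (simp add: t_L_def s_L_single)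

lemma s_L_q: "s_L N j q_L = q_L" "s_L N j qinv_L = qinv_L"
proof -
  interpret comm_ring_hom "s_pol N j :: int mpol \<Rightarrow> int mpol" by (rule comm_ring_hom_s_pol)
  show "s_L N j q_L = q_L" "s_L N j qinv_L = qinv_L"
    by (simp_all add: q_L_def qinv_L_def s_L_single)
qed

lemma qinv_q: "qinv_L * q_L = 1" "q_L * qinv_L = 1"
  by (simp_all add: q_L_def qinv_L_def mult_single single_one)

section \<open>The operators over polynomials and Laurent polynomials in q\<close>

lemma Lam_closed:
  "0 \<in> Lam N" "1 \<in> Lam N"
  "p \<in> Lam N \<Longrightarrow> r \<in> Lam N \<Longrightarrow> p - r \<in> Lam N"
  "p \<in> Lam N \<Longrightarrow> r \<in> Lam N \<Longrightarrow> p * r \<in> Lam N"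
  "i \<in> {1..N} \<Longrightarrow> T_var i \<in> Lam N"
proof -
  show "0 \<in> Lam N" by (simp add: Lam_def)
  show "1 \<in> Lam N" by (simp add: Lam_def flip: single_one)
  show "p \<in> Lam N \<Longrightarrow> r \<in> Lam N \<Longrightarrow> p - r \<in> Lam N"
    using keys_diff[of p r] by (auto simp: Lam_def)
  show "p \<in> Lam N \<Longrightarrow> r \<in> Lam N \<Longrightarrow> p * r \<in> Lam N"
  proof -
    assume pr: "p \<in> Lam N" "r \<in> Lam N"
    show "p * r \<in> Lam N"
      unfolding Lam_def
    proof (intro CollectI ballI)
      fix m assume "m \<in> Poly_Mapping.keys (p * r)"
      then obtain k l where "m = k + l" "k \<in> Poly_Mapping.keys p" "l \<in> Poly_Mapping.keys r"
        using keys_mult[of p r] by blast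
      moreover from this have "Poly_Mapping.keys k \<union> Poly_Mapping.keys l \<subseteq> {1..N}"
        using pr unfolding Lam_def by blast
      ultimately show "Poly_Mapping.keys m \<subseteq> {1..N}"
        using Poly_Mapping.keys_add[of k l] by blast
    qed
  qed
  show "i \<in> {1..N} \<Longrightarrow> T_var i \<in> Lam N" by (auto simp: Lam_def T_var_def)
qed

lemma swap_vars_Lam:
  assumes "p \<in> Lam N" "a \<in> {1..N}" "b \<in> {1..N}"
  shows "swap_vars a b p \<in> Lam N"
  unfolding Lam_def
proof (intro CollectI ballI subsetI)
  fix m i
  assume m: "m \<in> Poly_Mapping.keys (swap_vars a b p)" and i: "i \<in> Poly_Mapping.keys m"
  from m have "Poly_Mapping.map_key (transpose a b) m \<in> Poly_Mapping.keys p"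
    by (simp add: in_keys_iff lookup_swap_vars)
  then have "Poly_Mapping.keys (Poly_Mapping.map_key (transpose a b) m) \<subseteq> {1..N}"
    using assms(1) by (auto simp: Lam_def)
  moreover have "transpose a b i \<in> Poly_Mapping.keys (Poly_Mapping.map_key (transpose a b) m)"
    using i by (simp add: in_keys_iff lookup_map_key inj_transpose)
  ultimately have "transpose a b i \<in> {1..N}" by blast
  then show "i \<in> {1..N}" using assms(2,3) by (auto simp: transpose_def split: if_splits)
qed

lemma s_pol_Lam: "j \<in> {1..N} \<Longrightarrow> p \<in> Lam N \<Longrightarrow> s_pol N j p \<in> Lam N"
  unfolding s_pol_def using cyc_succ_in[of j N] by (intro swap_vars_Lam) auto

lemma lookup_single_times:
  fixes p :: "'k::ab_group_add \<Rightarrow>\<^sub>0 'b::comm_ring_1"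
  shows "Poly_Mapping.lookup (Poly_Mapping.single e a * p) k = a * Poly_Mapping.lookup p (k - e)"
proof (induction p rule: poly_mapping_add_induct)
  case (add p l c)
  have "(e + l = k) = (l = k - e)" by (auto simp: algebra_simps)
  with add show ?case
    by (simp add: distrib_left mult_single lookup_add lookup_single when_def)
qed simp

text \<open>The coefficient of $-\sigma_j^+\sigma_{j+1}^-$ in $\hat r_j$.\<close>

definition scalar_coeff :: "nat \<Rightarrow> nat \<Rightarrow> qlaurent" where
  "scalar_coeff N j = (if j = N then qinv_L else 1) * (t_L N j - t_L N (cyc_succ N j))"

lemma scalar_coeff_eq:
  "scalar_coeff N j = Poly_Mapping.single (if j = N then -1 else 0)
     (T_var (N + 1 - j) - T_var (N + 1 - cyc_succ N j))"
  by (simp add: scalar_coeff_def qinv_L_def t_L_def mult_single flip: single_diff)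


lemma bs_L_eq: "N \<ge> 2 \<Longrightarrow> bs_L N j = exchange_op (s_L N j) (scalar_coeff N j) j (cyc_succ N j)"
  by (simp add: bs_L_def affine_op_eq_exchange_op cyc_succ_neq scalar_coeff_def)

lemma bs_X_eq:
  "N \<ge> 2 \<Longrightarrow> bs_X N j = exchange_op (map_poly (s_L N j)) [:scalar_coeff N j:] j (cyc_succ N j)"
  by (simp add: bs_X_def affine_op_eq_exchange_op cyc_succ_neq scalar_coeff_def t_X_def mult.commute)

lemma bs_L_involution:
  assumes "N \<ge> 2" "j \<in> {1..N}"
  shows "bs_L N j (bs_L N j v) = v"
proof -
  interpret comm_ring_hom "s_L N j" by (rule comm_ring_hom_s_L)
  have "s_L N j (scalar_coeff N j) = - scalar_coeff N j"
    using s_L_t_L[OF assms(2,2)] s_L_t_L[OF assms(2) cyc_succ_in[OF assms(2)]]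
    by (simp add: scalar_coeff_def hom_mult hom_minus s_L_q algebra_simps)
  then show ?thesis
    unfolding bs_L_eq[OF assms(1)]
    using comm_ring_hom_s_L cyc_succ_neq[OF assms(1), of j] s_L_involution
    by (intro exchange_op_involution) auto
qed

lemma bs_L_commute:
  assumes "i \<in> {1..N}" "j \<in> {1..N}" "i \<noteq> j" "cyc_succ N i \<noteq> j" "cyc_succ N j \<noteq> i" "N \<ge> 2"
  shows "bs_L N i (bs_L N j v) = bs_L N j (bs_L N i v)"
proof -
  have fixed: "s_L N a (scalar_coeff N b) = scalar_coeff N b"
    if "a \<in> {1..N}" "b \<in> {1..N}" "a \<noteq> b" "cyc_succ N a \<noteq> b" "cyc_succ N b \<noteq> a" for a b
  proof -
    interpret comm_ring_hom "s_L N a" by (rule comm_ring_hom_s_L)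
    have "transpose a (cyc_succ N a) b = b"
      "transpose a (cyc_succ N a) (cyc_succ N b) = cyc_succ N b"
      using that cyc_succ_inj[OF that(1,2)] by (metis transpose_apply_other)+
    then show ?thesis
      using s_L_t_L[OF that(1,2)] s_L_t_L[OF that(1) cyc_succ_in[OF that(2)]]
      by (simp add: scalar_coeff_def hom_mult hom_minus s_L_q)
  qed
  have "cyc_succ N i \<noteq> cyc_succ N j" using cyc_succ_inj[OF assms(1,2)] assms(3) by blast
  then have distinct: "distinct [i, cyc_succ N i, j, cyc_succ N j]"
    using assms(3-5) cyc_succ_neq[OF assms(6), of i] cyc_succ_neq[OF assms(6), of j] by force
  show ?thesis
    unfolding bs_L_eq[OF assms(6)]
    by (rule exchange_op_far_commute[OF comm_ring_hom_s_L comm_ring_hom_s_L distinct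
          s_L_commute[OF assms] fixed[OF assms(1-5)] fixed[OF assms(2,1) assms(3)[symmetric] assms(5,4)]])
qed

lemma bs_L_braid:
  assumes "N \<ge> 3" "j \<in> {1..N}" "i = cyc_succ N j"
  shows "bs_L N j (bs_L N i (bs_L N j v)) = bs_L N i (bs_L N j (bs_L N i v))"
proof -
  have N: "N \<ge> 2" using assms(1) by simp
  define d where "d = cyc_succ N i"
  have ds: "distinct [j, i, d]"
    using cyc_succ_distinct[OF assms(1,2)] by (simp add: d_def assms(3))
  have i: "i \<in> {1..N}" unfolding assms(3) by (rule cyc_succ_in[OF assms(2)])
  have d: "d \<in> {1..N}" unfolding d_def by (rule cyc_succ_in[OF i])
  interpret s: comm_ring_hom "s_L N j" by (rule comm_ring_hom_s_L)
  interpret u: comm_ring_hom "s_L N i" by (rule comm_ring_hom_s_L)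
  have t: "s_L N j (t_L N j) = t_L N i" "s_L N j (t_L N i) = t_L N j" "s_L N j (t_L N d) = t_L N d"
    "s_L N i (t_L N j) = t_L N j" "s_L N i (t_L N i) = t_L N d" "s_L N i (t_L N d) = t_L N i"
    using ds s_L_t_L[OF assms(2), folded assms(3)] s_L_t_L[OF i, folded d_def] assms(2) i d
    by (simp_all del: atLeastAtMost_iff)
  have coeff: "scalar_coeff N j = (if j = N then qinv_L else 1) * (t_L N j - t_L N i)"
    "scalar_coeff N i = (if i = N then qinv_L else 1) * (t_L N i - t_L N d)"
    by (simp_all add: scalar_coeff_def assms(3) d_def)
  show ?thesis
    unfolding bs_L_eq[OF N] coeff assms(3)[symmetric] d_def[symmetric]
    by (rule exchange_op_braid[OF comm_ring_hom_s_L comm_ring_hom_s_L ds s_L_braid[OF assms]])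
      (simp_all add: t s.hom_minus u.hom_minus s_L_q)
qed

lemma bs_L_semilinear:
  assumes "N \<ge> 2"
  shows "semilinear_op (s_L N j) (bs_L N j)"
  unfolding bs_L_eq[OF assms] by (rule semilinear_exchange_op[OF comm_ring_hom_s_L])

lemma LamQ_inv_closed:
  "p \<in> LamQ_inv N \<Longrightarrow> r \<in> LamQ_inv N \<Longrightarrow> p - r \<in> LamQ_inv N"
  "0 \<in> LamQ_inv N"
  "j \<in> {1..N} \<Longrightarrow> p \<in> LamQ_inv N \<Longrightarrow> scalar_coeff N j * p \<in> LamQ_inv N"
  "j \<in> {1..N} \<Longrightarrow> p \<in> LamQ_inv N \<Longrightarrow> s_L N j p \<in> LamQ_inv N"
  using cyc_succ_in[of j N]
  by (auto simp: LamQ_inv_def lookup_minus lookup_s_L scalar_coeff_eq lookup_single_times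
      intro!: Lam_closed s_pol_Lam)

lemma LamQ_alt: "p \<in> LamQ N \<longleftrightarrow> p \<in> LamQ_inv N \<and> (\<forall>k<0. Poly_Mapping.lookup p k = 0)"
  unfolding LamQ_def mem_Collect_eq Ball_def in_keys_iff by (metis linorder_not_less)

lemma LamQ_closed:
  "p \<in> LamQ N \<Longrightarrow> r \<in> LamQ N \<Longrightarrow> p - r \<in> LamQ N"
  "0 \<in> LamQ N"
  "j \<in> {1..<N} \<Longrightarrow> p \<in> LamQ N \<Longrightarrow> scalar_coeff N j * p \<in> LamQ N"
  "j \<in> {1..N} \<Longrightarrow> p \<in> LamQ N \<Longrightarrow> s_L N j p \<in> LamQ N"
proof -
  interpret comm_ring_hom "s_pol N j :: int mpol \<Rightarrow> int mpol" by (rule comm_ring_hom_s_pol)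
  show "p \<in> LamQ N \<Longrightarrow> r \<in> LamQ N \<Longrightarrow> p - r \<in> LamQ N" "0 \<in> LamQ N"
    "j \<in> {1..N} \<Longrightarrow> p \<in> LamQ N \<Longrightarrow> s_L N j p \<in> LamQ N"
    by (auto simp: LamQ_alt LamQ_inv_closed lookup_minus lookup_s_L)
  show "scalar_coeff N j * p \<in> LamQ N" if "j \<in> {1..<N}" "p \<in> LamQ N"
    using that LamQ_inv_closed(3)[of j N p]
    by (auto simp: LamQ_alt scalar_coeff_eq lookup_single_times)
qed

lemma exchange_op_tensor_space:
  assumes "comm_ring_hom s" "a \<in> {1..N}" "b \<in> {1..N}"
    and "\<And>p. p \<in> R \<Longrightarrow> s p \<in> R" "\<And>p. p \<in> R \<Longrightarrow> c * p \<in> R"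
    and "\<And>p r. p \<in> R \<Longrightarrow> r \<in> R \<Longrightarrow> p - r \<in> R" "0 \<in> R"
    and v: "v \<in> tensor_space N R"
  shows "exchange_op s c a b v \<in> tensor_space N R"
  unfolding tensor_space_def
proof (intro CollectI allI conjI impI)
  fix S
  have vR: "v S' \<in> R" for S' using v by (simp add: tensor_space_def)
  show "exchange_op s c a b v S \<in> R"
    using assms(4-7) vR by (auto simp: exchange_op_def)
  interpret comm_ring_hom s by fact
  assume ne: "exchange_op s c a b v S \<noteq> 0"
  then have "v S \<noteq> 0 \<or> (a \<in> S \<and> v (insert b (S - {a})) \<noteq> 0)"
    by (auto simp: exchange_op_def split: if_splits)
  then have "S \<subseteq> {1..N} \<or> (insert b (S - {a}) \<subseteq> {1..N})"
    using v by (auto simp: tensor_space_def)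
  then show "S \<subseteq> {1..N}" using assms(2) by auto
qed

text \<open>The exchange replaces one element of a set by another and so preserves its size.\<close>

lemma exchange_op_weight_space:
  assumes "comm_ring_hom s" "a \<in> {1..N}" "b \<in> {1..N}"
    and "\<And>p. p \<in> R \<Longrightarrow> s p \<in> R" "\<And>p. p \<in> R \<Longrightarrow> c * p \<in> R"
    and "\<And>p r. p \<in> R \<Longrightarrow> r \<in> R \<Longrightarrow> p - r \<in> R" "0 \<in> R"
    and v: "v \<in> weight_space N n R"
  shows "exchange_op s c a b v \<in> weight_space N n R"
  unfolding weight_space_def
proof (intro CollectI allI conjI impI)
  show T: "exchange_op s c a b v \<in> tensor_space N R"
    using assms by (intro exchange_op_tensor_space) (auto simp: weight_space_def)
  fix S
  interpret comm_ring_hom s by fact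
  assume ne: "exchange_op s c a b v S \<noteq> 0"
  then have "S \<subseteq> {1..N}" using T by (auto simp: tensor_space_def)
  then have S: "finite S" by (rule finite_subset) simp
  from ne have "v S \<noteq> 0 \<or> (a \<in> S \<and> b \<notin> S \<and> v (insert b (S - {a})) \<noteq> 0)"
    by (auto simp: exchange_op_def split: if_splits)
  then have "card S = n \<or> (a \<in> S \<and> b \<notin> S \<and> card (insert b (S - {a})) = n)"
    using v by (auto simp: weight_space_def)
  moreover have "card (insert b (S - {a})) = card S" if "a \<in> S" "b \<notin> S"
    using that S by (metis Diff_iff finite_Diff card_insert_disjoint card_Suc_Diff1)
  ultimately show "card S = n" by argo
qed

lemma bs_L_weight_space:
  assumes "N \<ge> 2" "j \<in> {1..N}" "v \<in> weight_space N n (LamQ_inv N)"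
  shows "bs_L N j v \<in> weight_space N n (LamQ_inv N)"
  unfolding bs_L_eq[OF assms(1)]
  using assms cyc_succ_in[OF assms(2)]
  by (intro exchange_op_weight_space comm_ring_hom_s_L LamQ_inv_closed) auto

lemma comm_ring_hom_map_poly_s_L: "comm_ring_hom (map_poly (s_L N j))"
proof -
  interpret comm_ring_hom "s_L N j" by (rule comm_ring_hom_s_L)
  interpret m: map_poly_comm_ring_hom "s_L N j" ..
  show ?thesis ..
qed

lemma map_poly_s_L_const: "map_poly (s_L N j) [:c:] = [:s_L N j c:]"
proof -
  interpret comm_ring_hom "s_L N j" by (rule comm_ring_hom_s_L)
  show ?thesis by (rule poly_eqI) (simp add: coeff_map_poly coeff_pCons split: nat.split)
qed

lemma map_poly_s_L_x: "map_poly (s_L N j) x_X = x_X"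
proof -
  interpret comm_ring_hom "s_L N j" by (rule comm_ring_hom_s_L)
  show ?thesis by (rule poly_eqI) (simp add: x_X_def coeff_map_poly coeff_pCons split: nat.split)
qed

lemma map_poly_s_L_t_X:
  "j \<in> {1..N} \<Longrightarrow> i \<in> {1..N} \<Longrightarrow>
    map_poly (s_L N j) (t_X N i) = t_X N (transpose j (cyc_succ N j) i)"
  unfolding t_X_def map_poly_s_L_const by (simp only: s_L_t_L)

lemma poly_in_x_closed:
  "(\<And>a b. a \<in> R \<Longrightarrow> b \<in> R \<Longrightarrow> a - b \<in> R) \<Longrightarrow>
    p \<in> poly_in_x R \<Longrightarrow> r \<in> poly_in_x R \<Longrightarrow> p - r \<in> poly_in_x R"
  "0 \<in> R \<Longrightarrow> 0 \<in> poly_in_x R"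
  "(\<And>a. a \<in> R \<Longrightarrow> c * a \<in> R) \<Longrightarrow> p \<in> poly_in_x R \<Longrightarrow> [:c:] * p \<in> poly_in_x R"
  by (simp_all add: poly_in_x_def)

lemma map_poly_s_L_poly_in_x:
  "(\<And>a. a \<in> R \<Longrightarrow> s_L N j a \<in> R) \<Longrightarrow> p \<in> poly_in_x R \<Longrightarrow> map_poly (s_L N j) p \<in> poly_in_x R"
proof -
  interpret comm_ring_hom "s_L N j" by (rule comm_ring_hom_s_L)
  show "(\<And>a. a \<in> R \<Longrightarrow> s_L N j a \<in> R) \<Longrightarrow> p \<in> poly_in_x R \<Longrightarrow> map_poly (s_L N j) p \<in> poly_in_x R"
    by (simp add: poly_in_x_def coeff_map_poly)
qed

lemma bs_X_tensor_space:
  assumes "N \<ge> 2" "j \<in> {1..<N}" "v \<in> tensor_space N (poly_in_x (LamQ N))"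
  shows "bs_X N j v \<in> tensor_space N (poly_in_x (LamQ N))"
proof -
  have j: "j \<in> {1..N}" using assms(2) by auto
  show ?thesis
    unfolding bs_X_eq[OF assms(1)]
    by (rule exchange_op_tensor_space[OF comm_ring_hom_map_poly_s_L j cyc_succ_in[OF j]
          map_poly_s_L_poly_in_x[OF LamQ_closed(4)[OF j]]
          poly_in_x_closed(3)[OF LamQ_closed(3)[OF assms(2)]]
          poly_in_x_closed(1)[OF LamQ_closed(1)] poly_in_x_closed(2)[OF LamQ_closed(2)] assms(3)])
qed

lemma bs_X_monodromy:
  assumes "N \<ge> 2" "j \<in> {1..<N}"
  shows "entrywise (op_commute (bs_X N j)) (M_X N)"
proof -
  have j: "1 \<le> j" "j < N" "j \<in> {1..N}" "cyc_succ N j = Suc j"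
    using assms(2) by (auto simp: cyc_succ_def)
  show ?thesis
    unfolding bs_X_def M_X_def
    by (rule affine_op_commute_monodromy(1)[where act = "\<lambda>j. map_poly (s_L N j)" and t = "t_X N" and N = N
            and j = j and x = x_X,
          OF comm_ring_hom_map_poly_s_L j(1,2)
            map_poly_s_L_t_X[OF j(3), unfolded j(4)] map_poly_s_L_x])
qed

lemma bs_X_transfer:
  assumes "N \<ge> 2" "j \<in> {1..N}"
  shows "op_commute (bs_X N j) (H_X N)" "op_commute (bs_X N j) (E_X N)"
proof -
  have q: "map_poly (s_L N j) q_X = q_X" "map_poly (s_L N j) [:qinv_L:] = [:qinv_L:]"
    "[:qinv_L:] * q_X = 1"
    unfolding q_X_def by (simp_all only: map_poly_s_L_const s_L_q)
      (simp add: qinv_q one_pCons)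
  note commute = affine_op_commute_transfer[where act = "\<lambda>j. map_poly (s_L N j)" and t = "t_X N" and N = N
        and j = j and x = x_X and q = q_X and qinv = "[:qinv_L:]",
      OF comm_ring_hom_map_poly_s_L assms map_poly_s_L_t_X[OF assms(2)] map_poly_s_L_x q]
  show "op_commute (bs_X N j) (H_X N)" "op_commute (bs_X N j) (E_X N)"
    unfolding bs_X_def H_X_def E_X_def by (rule commute; assumption?)+
qed

lemma single_notin_LamQ_const:
  "k \<noteq> 0 \<Longrightarrow> c \<noteq> 0 \<Longrightarrow> Poly_Mapping.single k c \<notin> LamQ_const N"
  by (simp add: LamQ_const_def)

text \<open>The vector with ones at the first $n$ sites has a one at site $1$ and a zero at site $N$, so
$\hat r_N$ produces a new basis vector with coefficient $\pm q^{-1}(t_N - t_1)$.\<close>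

lemma bs_L_N_not_const:
  assumes "0 < n" "n < N" "N \<ge> 2"
  shows "basis_vec {1..n} \<in> weight_space N n (LamQ_const N)"
    and "bs_L N N (basis_vec {1..n}) \<notin> weight_space N n (LamQ_const N)"
proof -
  have const: "0 \<in> LamQ_const N" "1 \<in> LamQ_const N"
    by (auto simp: LamQ_const_def LamQ_inv_def lookup_one when_def intro: Lam_closed)
  show "basis_vec {1..n} \<in> weight_space N n (LamQ_const N)"
    unfolding weight_space_def tensor_space_def
  proof (intro CollectI conjI allI impI)
    fix S :: "nat set"
    show "basis_vec {1..n} S \<in> LamQ_const N"
      using const by (simp add: basis_vec_def)
    assume "basis_vec {1..n} S \<noteq> (0 :: qlaurent)"
    then have "S = {1..n}" by (simp add: basis_vec_def split: if_splits)
    then show "S \<subseteq> {1..N}" "card S = n" using assms by simp_all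
  qed
  interpret comm_ring_hom "s_L N N" by (rule comm_ring_hom_s_L)
  let ?S = "insert N ({1..n} - {1})"
  have N1: "cyc_succ N N = 1" by (simp add: cyc_succ_def)
  have S: "insert 1 (?S - {N}) = {1..n}" "1 \<notin> ?S" "?S \<noteq> {1..n}" "N \<in> ?S"
  proof -
    have "N \<notin> {1..n}" "1 \<in> {1..n}" "N \<noteq> 1" using assms by auto
    then show "insert 1 (?S - {N}) = {1..n}" "1 \<notin> ?S" "?S \<noteq> {1..n}" "N \<in> ?S" by blast+
  qed
  have "bs_L N N (basis_vec {1..n}) ?S = s_L N N (0 - scalar_coeff N N * 1)"
    unfolding bs_L_eq[OF assms(3)] exchange_op_def N1 basis_vec_def
    by (simp only: S if_True if_False simp_thms)
  also have "\<dots> = Poly_Mapping.single (-1) (- s_pol N N (T_var 1 - T_var N))"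
    by (simp only: mult_1_right diff_0 hom_uminus scalar_coeff_eq s_L_single N1 single_uminus
        if_True simp_thms add_diff_cancel_left' add_diff_cancel_right')
  finally have *: "bs_L N N (basis_vec {1..n}) ?S =
    Poly_Mapping.single (-1) (- s_pol N N (T_var 1 - T_var N))" .
  interpret p: comm_ring_hom "s_pol N N :: int mpol \<Rightarrow> int mpol" by (rule comm_ring_hom_s_pol)
  have "T_var 1 \<noteq> (T_var N :: int mpol)"
    using assms by (simp add: T_var_inject)
  moreover have "s_pol N N (s_pol N N (T_var 1 - T_var N)) = T_var 1 - (T_var N :: int mpol)"
    by (rule s_pol_involution)
  ultimately have "s_pol N N (T_var 1 - T_var N) \<noteq> (0 :: int mpol)"
    by (metis p.hom_zero right_minus_eq)
  then have "bs_L N N (basis_vec {1..n}) ?S \<notin> LamQ_const N"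
    unfolding * by (intro single_notin_LamQ_const) (simp_all only: neg_equal_0_iff_equal, simp)
  moreover have "v ?S \<in> LamQ_const N" if "v \<in> weight_space N n (LamQ_const N)" for v
    using that by (simp add: weight_space_def tensor_space_def)
  ultimately show "bs_L N N (basis_vec {1..n}) \<notin> weight_space N n (LamQ_const N)"
    by metis
qed

section \<open>The affine symmetric group and its actions\<close>

lemma word_eq_context:
  "word_eq N u v \<Longrightarrow> word_eq N (p @ u @ r) (p @ v @ r)"
proof (induction rule: word_eq.induct)
  case (invol j u v)
  then show ?case using word_eq.invol[of j N "p @ u" "v @ r"] by simp
next
  case (braid j u v)
  then show ?case using word_eq.braid[of N j "p @ u" "v @ r"] by simp
next
  case (commute i j u v)
  then show ?case using word_eq.commute[of i N j "p @ u" "v @ r"] by simp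
qed (auto intro: word_eq.intros)

lemma equiv_word_rel: "equiv (lists {1..N}) (word_rel N)"
  by (rule equivI) (auto simp: word_rel_def refl_on_def intro!: symI transI intro: word_eq.intros)

lemma word_eq_append:
  assumes "word_eq N u u'" "word_eq N v v'"
  shows "word_eq N (u @ v) (u' @ v')"
  using word_eq_context[OF assms(1), of "[]" v] word_eq_context[OF assms(2), of u' "[]"]
  by (auto intro: word_eq.trans)

abbreviation word_class :: "nat \<Rightarrow> nat list \<Rightarrow> nat list set" where
  "word_class N u \<equiv> word_rel N `` {u}"

lemma word_class_eq_iff:
  "u \<in> lists {1..N} \<Longrightarrow> v \<in> lists {1..N} \<Longrightarrow> word_class N u = word_class N v \<longleftrightarrow> word_eq N u v"
  using eq_equiv_class_iff[OF equiv_word_rel, of u N v] by (auto simp: word_rel_def)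

lemma affine_sym_mult:
  assumes "u \<in> lists {1..N}" "v \<in> lists {1..N}"
  shows "word_class N u \<otimes>\<^bsub>affine_sym N\<^esub> word_class N v = word_class N (u @ v)"
proof -
  have "congruent2 (word_rel N) (word_rel N) (\<lambda>u v. word_class N (u @ v))"
  proof (rule congruent2I')
    fix u u' v v' assume uv: "(u, u') \<in> word_rel N" "(v, v') \<in> word_rel N"
    then have "u @ v \<in> lists {1..N}" "u' @ v' \<in> lists {1..N}"
      unfolding word_rel_def by auto
    moreover have "word_eq N (u @ v) (u' @ v')"
      using uv by (auto simp: word_rel_def intro: word_eq_append)
    ultimately show "word_class N (u @ v) = word_class N (u' @ v')"
      by (simp only: word_class_eq_iff)
  qed
  then have "(\<Union>x \<in> word_class N u. \<Union>y \<in> word_class N v. word_class N (x @ y)) = word_class N (u @ v)"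
    using UN_equiv_class2[OF equiv_word_rel equiv_word_rel] assms by blast
  then show ?thesis by (simp add: affine_sym_def)
qed

lemma word_eq_rev_cancel: "u \<in> lists {1..N} \<Longrightarrow> word_eq N (rev u @ u) []"
proof (induction u)
  case (Cons j u)
  have "word_eq N (rev u @ [j, j] @ u) (rev u @ u)"
    using Cons.prems by (intro word_eq.invol) auto
  then show ?case using Cons by (auto intro: word_eq.trans)
qed (simp add: word_eq.refl)

lemma carrier_affine_sym: "carrier (affine_sym N) = word_class N ` lists {1..N}"
  by (auto simp: affine_sym_def quotient_def)

lemma group_affine_sym: "group (affine_sym N)"
proof (rule groupI)
  have one: "\<one>\<^bsub>affine_sym N\<^esub> = word_class N []" by (simp add: affine_sym_def)
  show "\<one>\<^bsub>affine_sym N\<^esub> \<in> carrier (affine_sym N)"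
    by (auto simp: one carrier_affine_sym)
  fix x assume "x \<in> carrier (affine_sym N)"
  then obtain u where u: "u \<in> lists {1..N}" "x = word_class N u" by (auto simp: carrier_affine_sym)
  show "\<one>\<^bsub>affine_sym N\<^esub> \<otimes>\<^bsub>affine_sym N\<^esub> x = x"
    using u by (simp add: one affine_sym_mult)
  have ru: "rev u \<in> lists {1..N}" using u by auto
  then have "word_class N (rev u) \<otimes>\<^bsub>affine_sym N\<^esub> x = \<one>\<^bsub>affine_sym N\<^esub>"
    using u word_eq_rev_cancel[OF u(1)] word_class_eq_iff[of "rev u @ u" N "[]"]
    by (simp add: affine_sym_mult one)
  then show "\<exists>y\<in>carrier (affine_sym N). y \<otimes>\<^bsub>affine_sym N\<^esub> x = \<one>\<^bsub>affine_sym N\<^esub>"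
    using ru by (auto simp: carrier_affine_sym)
  fix y assume "y \<in> carrier (affine_sym N)"
  then obtain v where v: "v \<in> lists {1..N}" "y = word_class N v" by (auto simp: carrier_affine_sym)
  show "x \<otimes>\<^bsub>affine_sym N\<^esub> y \<in> carrier (affine_sym N)"
    using u v by (auto simp: affine_sym_mult carrier_affine_sym)
  fix z assume "z \<in> carrier (affine_sym N)"
  then obtain w where w: "w \<in> lists {1..N}" "z = word_class N w" by (auto simp: carrier_affine_sym)
  show "(x \<otimes>\<^bsub>affine_sym N\<^esub> y) \<otimes>\<^bsub>affine_sym N\<^esub> z = x \<otimes>\<^bsub>affine_sym N\<^esub> (y \<otimes>\<^bsub>affine_sym N\<^esub> z)"
    using u v w by (simp add: affine_sym_mult)
qed

lemma foldr_word_eq: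
  assumes "word_eq N u v"
    and "\<And>j v. j \<in> {1..N} \<Longrightarrow> f j (f j v) = v"
    and "\<And>j v. N \<ge> 3 \<Longrightarrow> j \<in> {1..N} \<Longrightarrow>
      f j (f (cyc_succ N j) (f j v)) = f (cyc_succ N j) (f j (f (cyc_succ N j) v))"
    and "\<And>i j v. i \<in> {1..N} \<Longrightarrow> j \<in> {1..N} \<Longrightarrow> i \<noteq> j \<Longrightarrow> cyc_succ N i \<noteq> j \<Longrightarrow> cyc_succ N j \<noteq> i \<Longrightarrow>
      f i (f j v) = f j (f i v)"
  shows "foldr f u x = foldr f v x"
  using assms(1)
proof (induction rule: word_eq.induct)
  case (commute i j u v)
  then show ?case using assms(4)[OF commute] by simp
qed (simp_all add: assms(2,3))

text \<open>A word acts by composing its letters, and words that are equal in the group act equally by the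
Coxeter relations. Bijectivity comes for free: the reversed word acts by the inverse.\<close>

theorem affine_sym_action:
  fixes f :: "nat \<Rightarrow> 'v \<Rightarrow> 'v"
  assumes E: "\<And>j v. j \<in> {1..N} \<Longrightarrow> v \<in> E \<Longrightarrow> f j v \<in> E"
    and invol: "\<And>j v. j \<in> {1..N} \<Longrightarrow> f j (f j v) = v"
    and braid: "\<And>j v. N \<ge> 3 \<Longrightarrow> j \<in> {1..N} \<Longrightarrow>
      f j (f (cyc_succ N j) (f j v)) = f (cyc_succ N j) (f j (f (cyc_succ N j) v))"
    and commute: "\<And>i j v. i \<in> {1..N} \<Longrightarrow> j \<in> {1..N} \<Longrightarrow> i \<noteq> j \<Longrightarrow> cyc_succ N i \<noteq> j \<Longrightarrow> cyc_succ N j \<noteq> i \<Longrightarrow>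
      f i (f j v) = f j (f i v)"
  shows "\<exists>\<phi>. group_action (affine_sym N) E \<phi> \<and>
    (\<forall>j \<in> {1..N}. \<forall>v \<in> E. \<phi> (affine_gen N j) v = f j v)"
proof -
  \<comment> \<open>By \<open>fold\<close> below the chosen word is irrelevant; elements of \<open>BijGroup E\<close> must be undefined off E.\<close>
  define \<phi> where "\<phi> A = restrict (foldr f (SOME u. u \<in> A)) E" for A
  have fold: "foldr f u x = foldr f v x" if "word_eq N u v" for u v x
    using that invol braid commute by (rule foldr_word_eq)
  have \<phi>: "\<phi> (word_class N u) = restrict (foldr f u) E" if "u \<in> lists {1..N}" for u
  proof -
    have "u \<in> word_class N u" using that by (simp add: word_rel_def word_eq.refl)
    moreover have "word_eq N u v" if "v \<in> word_class N u" for v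
      using that by (simp add: word_rel_def)
    ultimately have "word_eq N u (SOME v. v \<in> word_class N u)" by (metis someI)
    then show ?thesis using fold by (fastforce simp: \<phi>_def)
  qed
  have foldE: "foldr f u x \<in> E" if "u \<in> lists {1..N}" "x \<in> E" for u x
    using that by (induction u) (auto intro: E)
  have cancel: "foldr f (rev u) (foldr f u x) = x" if "u \<in> lists {1..N}" for u x
    using fold[OF word_eq_rev_cancel[OF that]] by simp
  have bij: "restrict (foldr f u) E \<in> Bij E" if "u \<in> lists {1..N}" for u
  proof -
    have ru: "rev u \<in> lists {1..N}" using that by auto
    have "bij_betw (foldr f u) E E"
      using foldE[OF that] foldE[OF ru] cancel[OF that] cancel[OF ru]
      by (intro bij_betw_byWitness[where f' = "foldr f (rev u)"]) auto
    then show ?thesis by (auto simp: Bij_def bij_betw_restrict_eq)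
  qed
  have "group_action (affine_sym N) E \<phi>"
    unfolding group_action_def group_hom_def group_hom_axioms_def
  proof (intro conjI group_affine_sym group_BijGroup homI)
    fix x assume "x \<in> carrier (affine_sym N)"
    then obtain u where u: "u \<in> lists {1..N}" "x = word_class N u" by (auto simp: carrier_affine_sym)
    show "\<phi> x \<in> carrier (BijGroup E)"
      using u bij by (simp add: \<phi> BijGroup_def)
    fix y assume "y \<in> carrier (affine_sym N)"
    then obtain v where v: "v \<in> lists {1..N}" "y = word_class N v" by (auto simp: carrier_affine_sym)
    have uv: "u @ v \<in> lists {1..N}" using u v by simp
    have "compose E (restrict (foldr f u) E) (restrict (foldr f v) E) = restrict (foldr f (u @ v)) E"
      using foldE[OF v(1)] by (auto simp: compose_def fun_eq_iff)
    then show "\<phi> (x \<otimes>\<^bsub>affine_sym N\<^esub> y) = \<phi> x \<otimes>\<^bsub>BijGroup E\<^esub> \<phi> y"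
      using u v uv bij[OF u(1)] bij[OF v(1)]
      by (simp add: affine_sym_mult \<phi> BijGroup_def del: append_in_lists_conv)
  qed
  moreover have "\<phi> (affine_gen N j) v = f j v" if "j \<in> {1..N}" "v \<in> E" for j v
    using that \<phi>[of "[j]"] by (simp add: affine_gen_def)
  ultimately show ?thesis by blast
qed

section \<open>Factorial Schur functions\<close>

text \<open>For $r < m$ the product $(x|a)^r$ contains neither of $x - a_m$, $x - a_{m+1}$, for $r > m$ it
contains both; only for $r = m$ does it contain exactly one.\<close>

lemma factorial_power_swap:
  fixes a :: "nat \<Rightarrow> 'a::comm_ring_1"
  assumes "m \<ge> 1"
  shows "factorial_power x (a \<circ> transpose m (Suc m)) r =
    factorial_power x a r +
      (if r = m then (a m - a (Suc m)) * factorial_power x a (m - 1) else 0)"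
proof -
  consider "r < m" | "r = m" | "r > m" by linarith
  then show ?thesis
  proof cases
    case 1
    then show ?thesis
      by (auto simp: factorial_power_def transpose_def intro!: prod.cong)
  next
    case 2
    obtain l where l: "m = Suc l" using assms by (cases m) auto
    have "(\<Prod>i = 1..l. x - a (transpose m (Suc m) i)) = (\<Prod>i = 1..l. x - a i)"
      by (rule prod.cong) (auto simp: l transpose_def)
    then show ?thesis
      using 2 by (simp add: factorial_power_def l algebra_simps)
  next
    case 3
    then have "transpose m (Suc m) permutes {1..r}"
      using assms by (intro permutes_swap_id) auto
    from prod.permute[OF this, of "\<lambda>i. x - a i"] 3 show ?thesis
      by (simp add: factorial_power_def comp_def)
  qed
qed

text \<open>The alternant whose $i$-th row has degree $e_i$, rows being counted from $0$.\<close>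

definition schur_det :: "nat \<Rightarrow> (nat \<Rightarrow> nat) \<Rightarrow> 'a::comm_ring_1 list \<Rightarrow> (nat \<Rightarrow> 'a) \<Rightarrow> 'a" where
  "schur_det n e xs a = det (mat n n (\<lambda>(i, j). factorial_power (xs ! j) a (e i)))"

lemma schur_det_cong:
  "(\<And>i. i < n \<Longrightarrow> e i = e' i) \<Longrightarrow> schur_det n e xs a = schur_det n e' xs a"
  unfolding schur_det_def by (rule arg_cong[where f = det]) (auto intro!: eq_matI)

lemma schur_det_repeated:
  assumes "i < n" "j < n" "i \<noteq> j" "e i = e j"
  shows "schur_det n e xs a = 0"
  unfolding schur_det_def
  using assms by (intro det_identical_rows[of _ n i j]) auto

lemma schur_det_swap_const:
  assumes "m \<ge> 1" "\<And>i. i < n \<Longrightarrow> e i \<noteq> m"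
  shows "schur_det n e xs (a \<circ> transpose m (Suc m)) = schur_det n e xs a"
  unfolding schur_det_def
  using assms(2) by (intro arg_cong[where f = det] eq_matI) (auto simp: factorial_power_swap[OF assms(1)])

text \<open>Since the degrees are distinct, a single row changes, and the determinant is linear in it.\<close>

lemma schur_det_swap:
  assumes m: "m \<ge> 1" and e: "inj_on e {..<n}" and l: "l < n" "e l = m"
  shows "schur_det n e xs (a \<circ> transpose m (Suc m)) =
    schur_det n e xs a + (a m - a (Suc m)) * schur_det n (e(l := m - 1)) xs a"
proof -
  let ?A = "\<lambda>e a i j. factorial_power (xs ! j) a (e i)"
  let ?e = "e(l := m - 1)" and ?a = "a \<circ> transpose m (Suc m)" and ?c = "a m - a (Suc m)"
  have row: "?A e ?a i j = ?A e a i j" "?A ?e a i j = ?A e a i j" if "i \<in> {0..<n} - {l}" for i j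
  proof -
    have "e i \<noteq> m" using that e l by (auto dest: inj_onD)
    then show "?A e ?a i j = ?A e a i j" by (simp add: factorial_power_swap[OF m])
    show "?A ?e a i j = ?A e a i j" using that by simp
  qed
  have "(\<Prod>i = 0..<n. ?A e ?a i (p i)) =
    (\<Prod>i = 0..<n. ?A e a i (p i)) + ?c * (\<Prod>i = 0..<n. ?A ?e a i (p i))" for p
  proof -
    have ln: "l \<in> {0..<n}" using l by simp
    have rest: "(\<Prod>i \<in> {0..<n} - {l}. ?A e ?a i (p i)) = (\<Prod>i \<in> {0..<n} - {l}. ?A e a i (p i))"
      "(\<Prod>i \<in> {0..<n} - {l}. ?A ?e a i (p i)) = (\<Prod>i \<in> {0..<n} - {l}. ?A e a i (p i))"
      by (rule prod.cong; simp only: row)+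
    have "(\<Prod>i = 0..<n. ?A e ?a i (p i)) = ?A e ?a l (p l) * (\<Prod>i \<in> {0..<n} - {l}. ?A e a i (p i))"
      by (simp add: prod.remove[OF _ ln] rest)
    also have "?A e ?a l (p l) = ?A e a l (p l) + ?c * ?A ?e a l (p l)"
      by (simp add: factorial_power_swap[OF m] l)
    also have "(\<dots>) * (\<Prod>i \<in> {0..<n} - {l}. ?A e a i (p i)) =
      ?A e a l (p l) * (\<Prod>i \<in> {0..<n} - {l}. ?A e a i (p i)) +
      ?c * (?A ?e a l (p l) * (\<Prod>i \<in> {0..<n} - {l}. ?A ?e a i (p i)))"
      by (simp only: rest distrib_right mult.assoc)
    also have "\<dots> = (\<Prod>i = 0..<n. ?A e a i (p i)) + ?c * (\<Prod>i = 0..<n. ?A ?e a i (p i))"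
      by (simp only: prod.remove[OF finite_atLeastLessThan ln])
    finally show ?thesis .
  qed
  note expand = this
  have "schur_det n e' xs a' =
      (\<Sum>p | p permutes {0..<n}. signof p * (\<Prod>i = 0..<n. ?A e' a' i (p i)))" for e' a'
    unfolding schur_det_def
    by (subst det_def', rule mat_carrier)
      (auto intro!: sum.cong prod.cong simp: permutes_in_image)
  then show ?thesis
    by (simp add: expand distrib_left sum.distrib sum_distrib_left mult.left_commute)
qed

lemma schur_det_permute:
  assumes p: "p permutes {..<n}" and len: "length xs = n"
  shows "schur_det n e (permute_list p xs) a = signof p * schur_det n e xs a"
proof -
  let ?M = "mat n n (\<lambda>(i, j). factorial_power (xs ! j) a (e i))"
  let ?B = "mat n n (\<lambda>(i, j). transpose_mat ?M $$ (p i, j))"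
  have p': "p permutes {0..<n}" using p by (simp add: lessThan_atLeast0)
  have "mat n n (\<lambda>(i, j). factorial_power (permute_list p xs ! j) a (e i)) = transpose_mat ?B"
    using p' permute_list_nth[of p xs] len p
    by (intro eq_matI) (auto simp: permutes_in_image)
  then have "schur_det n e (permute_list p xs) a = det (transpose_mat ?B)"
    by (simp add: schur_det_def)
  also have "\<dots> = det ?B" by (rule det_transpose[of _ n]) simp
  also have "\<dots> = signof p * det (transpose_mat ?M)"
    by (rule det_permute_rows[OF _ p']) simp
  also have "det (transpose_mat ?M) = det ?M" by (rule det_transpose[of _ n]) simp
  finally show ?thesis by (simp add: schur_det_def)
qed

text \<open>The factorial Schur function $s_\lambda$ for $e_i = \lambda_{i+1} + n - i - 1$.\<close>

definition schur_quot :: "nat \<Rightarrow> (nat \<Rightarrow> nat) \<Rightarrow> 'a::field list \<Rightarrow> (nat \<Rightarrow> 'a) \<Rightarrow> 'a" where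
  "schur_quot n e xs a = schur_det n e xs a / schur_det n (\<lambda>i. n - Suc i) xs a"

text \<open>Numerator and denominator change by the same sign. Tuples with repeated entries are included: there
both sides are quotients by zero, hence zero.\<close>

lemma schur_quot_permute:
  assumes "mset xs = mset ys" "length xs = n"
  shows "schur_quot n e xs a = schur_quot n e ys a"
proof -
  obtain p where p: "p permutes {..<length ys}" "permute_list p ys = xs"
    using mset_eq_permutation[OF assms(1)] by blast
  have len: "length ys = n" using assms by (metis size_mset)
  show ?thesis
    using schur_det_permute[of p n ys _ a] p len
    by (auto simp: schur_quot_def sign_def)
qed

text \<open>If the degree $m \ge 1$ occurs among $n - 1, \dots, 0$ then so does $m - 1$, and the correction in
\<open>schur_det_swap\<close> is an alternant with two equal rows.\<close>

lemma schur_det_vandermonde_swap: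
  assumes "m \<ge> 1"
  shows "schur_det n (\<lambda>i. n - Suc i) xs (a \<circ> transpose m (Suc m)) = schur_det n (\<lambda>i. n - Suc i) xs a"
proof (cases "m < n")
  case True
  have "schur_det n ((\<lambda>i. n - Suc i)(n - Suc m := m - 1)) xs a = 0"
    using True assms by (intro schur_det_repeated[of "n - Suc m" _ "n - m"]) auto
  moreover have "inj_on (\<lambda>i. n - Suc i) {..<n}" by (auto intro!: inj_onI)
  ultimately show ?thesis
    using schur_det_swap[OF assms, of "\<lambda>i. n - Suc i" n "n - Suc m" xs a] True by simp
next
  case False
  then show ?thesis by (intro schur_det_swap_const assms) auto
qed

text \<open>The row degrees $\lambda^\vee_i + n - i$ of $s_{\lambda^\vee}$ are the numbers $N - l$ with
$l \in I(\lambda)$. Indexing by the subset $S = I(\lambda)$ makes the effect of moving one element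
of $S$ visible.\<close>

definition set_exponent :: "nat \<Rightarrow> nat set \<Rightarrow> nat \<Rightarrow> nat" where
  "set_exponent N S i = N - sorted_list_of_set S ! i"

text \<open>No element lies strictly between $j$ and $j + 1$, so replacing one by the other keeps the order and
alters a single row degree.\<close>

lemma sorted_list_of_set_exchange:
  assumes "finite S" "j \<in> S" "Suc j \<notin> S"
  obtains l where "l < card S" "sorted_list_of_set S ! l = j"
    "sorted_list_of_set (insert (Suc j) (S - {j})) = (sorted_list_of_set S)[l := Suc j]"
proof -
  let ?xs = "sorted_list_of_set S"
  have s: "sorted_wrt (<) ?xs" "set ?xs = S" "length ?xs = card S"
    using assms(1) by simp_all
  then obtain l where l: "l < card S" "?xs ! l = j"
    using assms(2) by (metis in_set_conv_nth)
  have mono: "?xs ! i < ?xs ! i'" if "i < i'" "i' < card S" for i i'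
    using s that by (simp add: sorted_wrt_iff_nth_less)
  have ne: "?xs ! i \<noteq> Suc j" if "i < card S" for i
    using assms(3) s that by (metis nth_mem)
  have "sorted_wrt (<) (?xs[l := Suc j])"
    unfolding sorted_wrt_iff_nth_less
  proof (intro allI impI)
    fix i i' assume i: "i < i'" "i' < length (?xs[l := Suc j])"
    then show "?xs[l := Suc j] ! i < ?xs[l := Suc j] ! i'"
      using mono[of i i'] l s(3) ne[of i'] by (auto simp: nth_list_update)
  qed
  moreover have "set (?xs[l := Suc j]) = insert (Suc j) (S - {j})"
    using s l assms(1) set_update_distinct[of ?xs l "Suc j"] by simp
  ultimately have "sorted_list_of_set (insert (Suc j) (S - {j})) = ?xs[l := Suc j]"
    by (metis sorted_list_of_set.idem_if_sorted_distinct strict_sorted_iff)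
  with l show ?thesis by (rule that)
qed

lemma set_exponent_inj:
  assumes "S \<subseteq> {1..N}"
  shows "inj_on (set_exponent N S) {..<card S}"
proof (rule inj_onI)
  have fin: "finite S" using assms by (rule finite_subset) simp
  have le: "sorted_list_of_set S ! i \<le> N" if "i < card S" for i
    using assms fin that nth_mem[of i "sorted_list_of_set S"] by auto
  fix i j assume "i \<in> {..<card S}" "j \<in> {..<card S}" "set_exponent N S i = set_exponent N S j"
  then have "sorted_list_of_set S ! i = sorted_list_of_set S ! j"
    using le[of i] le[of j] by (auto simp: set_exponent_def)
  then show "i = j" using \<open>i \<in> _\<close> \<open>j \<in> _\<close> fin by (simp add: nth_eq_iff_index_eq)
qed

lemma set_exponent_image:
  assumes "S \<subseteq> {1..N}"
  shows "set_exponent N S ` {..<card S} = (\<lambda>i. N - i) ` S"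
proof -
  have "finite S" using assms by (rule finite_subset) simp
  then have "S = (\<lambda>i. sorted_list_of_set S ! i) ` {..<card S}"
    using nth_image[of "card S" "sorted_list_of_set S"] by (simp add: lessThan_atLeast0)
  then have "(\<lambda>i. N - i) ` S = (\<lambda>i. N - i) ` (\<lambda>i. sorted_list_of_set S ! i) ` {..<card S}"
    by simp
  then show ?thesis by (simp add: set_exponent_def image_image)
qed

text \<open>With $m = N - j$, the degree $m$ occurs iff $j \in S$ and $m - 1$ occurs iff $j + 1 \in S$. The
alternant with degree $m$ lowered to $m - 1$ vanishes if $m - 1$ already occurs, and otherwise belongs
to the set in which $j$ is replaced by $j + 1$.\<close>

theorem schur_quot_swap:
  fixes a :: "nat \<Rightarrow> 'a::field"
  assumes S: "S \<subseteq> {1..N}" "card S = n" and j: "1 \<le> j" "j < N"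
  defines "m \<equiv> N - j"
  shows "schur_quot n (set_exponent N S) xs (a \<circ> transpose m (Suc m)) =
    schur_quot n (set_exponent N S) xs a +
      (if j \<in> S \<and> Suc j \<notin> S
       then (a m - a (Suc m)) * schur_quot n (set_exponent N (insert (Suc j) (S - {j}))) xs a else 0)"
proof -
  let ?e = "set_exponent N S"
  have m: "m \<ge> 1" using j by (simp add: m_def)
  have fin: "finite S" using S by (meson finite_atLeastAtMost finite_subset)
  have in_image: "(\<exists>i<n. ?e i = N - k) \<longleftrightarrow> k \<in> S" if "k \<in> {1..N}" for k
  proof -
    have "(\<exists>i<n. ?e i = N - k) \<longleftrightarrow> N - k \<in> ?e ` {..<card S}"
      unfolding S(2) image_iff by (metis lessThan_iff)
    also have "\<dots> \<longleftrightarrow> (\<exists>i\<in>S. N - k = N - i)"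
      unfolding set_exponent_image[OF S(1)] image_iff ..
    also have "\<dots> \<longleftrightarrow> k \<in> S"
    proof -
      have "i = k" if "N - k = N - i" "i \<in> S" for i
      proof -
        have "i \<in> {1..N}" using S(1) that(2) by blast
        then show ?thesis using that(1) \<open>k \<in> {1..N}\<close> by (metis atLeastAtMost_iff diff_diff_cancel)
      qed
      then show ?thesis by blast
    qed
    finally show ?thesis .
  qed
  have inj: "inj_on ?e {..<n}" using set_exponent_inj[OF S(1)] S(2) by simp
  have num: "schur_det n ?e xs (a \<circ> transpose m (Suc m)) = schur_det n ?e xs a +
      (if j \<in> S \<and> Suc j \<notin> S
       then (a m - a (Suc m)) * schur_det n (set_exponent N (insert (Suc j) (S - {j}))) xs a else 0)"
  proof (cases "j \<in> S")
    case False
    then have "?e i \<noteq> m" if "i < n" for i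
      using in_image[of j] j that by (auto simp: m_def)
    then show ?thesis using False by (simp add: schur_det_swap_const[OF m])
  next
    case True
    show ?thesis
    proof (cases "Suc j \<in> S")
      case sj: True
      obtain l where l: "l < n" "?e l = m" using True in_image[of j] j by (auto simp: m_def)
      obtain l' where l': "l' < n" "?e l' = m - 1"
        using sj in_image[of "Suc j"] j by (auto simp: m_def)
      have "schur_det n (?e(l := m - 1)) xs a = 0"
        using l l' m by (intro schur_det_repeated[of l n l']) auto
      then show ?thesis using schur_det_swap[OF m inj l, of xs a] sj by simp
    next
      case False
      obtain l where l: "l < card S" "sorted_list_of_set S ! l = j"
        "sorted_list_of_set (insert (Suc j) (S - {j})) = (sorted_list_of_set S)[l := Suc j]"
        using sorted_list_of_set_exchange[OF fin True False] by blast
      have "schur_det n (?e(l := m - 1)) xs a =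
        schur_det n (set_exponent N (insert (Suc j) (S - {j}))) xs a"
        using l S(2) fin by (intro schur_det_cong) (auto simp: set_exponent_def nth_list_update m_def)
      moreover have "l < n" "?e l = m" using l S(2) by (auto simp: set_exponent_def m_def)
      ultimately show ?thesis using schur_det_swap[OF m inj, of l xs a] True False by simp
    qed
  qed
  show ?thesis
    unfolding schur_quot_def schur_det_vandermonde_swap[OF m] num
    by (auto simp: add_divide_distrib)
qed

section \<open>Partitions and subsets\<close>

text \<open>The elements of $I(\lambda)$ in increasing order.\<close>

definition part_list :: "nat list \<Rightarrow> nat list" where
  "part_list la = map (\<lambda>i. la ! (length la - Suc i) + Suc i) [0..<length la]"

lemma set_part_list: "set (part_list la) = part_set la"
proof -
  have "part_set la = (\<lambda>i. la ! (length la - i) + i) ` {1..length la}"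
    by (auto simp: part_set_def)
  also have "{1..length la} = Suc ` {0..<length la}"
    by (simp add: image_Suc_atLeastLessThan atLeastLessThanSuc_atLeastAtMost)
  finally show ?thesis by (simp only: part_list_def set_map set_upt image_image)
qed

lemma sorted_part_list:
  assumes "la \<in> partitions n k"
  shows "sorted_wrt (<) (part_list la)"
  unfolding sorted_wrt_iff_nth_less
proof (intro allI impI)
  fix i j assume ij: "i < j" "j < length (part_list la)"
  have "la ! (length la - Suc i) \<le> la ! (length la - Suc j)"
    using ij assms by (auto simp: part_list_def partitions_def sorted_wrt_iff_nth_less)
  then show "part_list la ! i < part_list la ! j"
    using ij by (simp add: part_list_def)
qed

lemma sorted_list_of_part_set:
  "la \<in> partitions n k \<Longrightarrow> sorted_list_of_set (part_set la) = part_list la"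
  using sorted_part_list[of la n k] set_part_list[of la]
  by (metis sorted_list_of_set.idem_if_sorted_distinct strict_sorted_iff)

lemma part_set_subset:
  assumes "la \<in> partitions n (N - n)" "n \<le> N"
  shows "part_set la \<subseteq> {1..N}" "card (part_set la) = n"
proof -
  have len: "length la = n" using assms by (simp add: partitions_def)
  have "la ! (length la - i) + i \<le> N" if "1 \<le> i" "i \<le> length la" for i
  proof -
    have "la ! (length la - i) \<le> N - n"
      using that assms nth_mem[of "length la - i" la] by (auto simp: partitions_def)
    then show ?thesis using that(2) len assms(2) by simp
  qed
  then show "part_set la \<subseteq> {1..N}"
    by (auto simp: part_set_def)
  have "distinct (part_list la)" using sorted_part_list[OF assms(1)] by (simp add: strict_sorted_iff)
  then show "card (part_set la) = n"
    using assms distinct_card[of "part_list la"]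
    by (simp add: set_part_list) (simp add: part_list_def partitions_def)
qed

lemma part_set_inject:
  assumes "la \<in> partitions n k" "mu \<in> partitions n k" "part_set la = part_set mu"
  shows "la = mu"
proof (rule nth_equalityI)
  show len: "length la = length mu" using assms by (simp add: partitions_def)
  have eq: "part_list la = part_list mu"
    using assms sorted_list_of_part_set by metis
  fix i assume "i < length la"
  then have "part_list la ! (length la - Suc i) = part_list mu ! (length la - Suc i)"
    "length la - Suc (length la - Suc i) = i"
    using eq by auto
  then show "la ! i = mu ! i" using len \<open>i < length la\<close> by (simp add: part_list_def)
qed

text \<open>The $i$-th smallest element of $S$ exceeds $i$ by the part $\lambda_{n+1-i}$; these excesses increase
weakly with $i$ because the elements increase strictly.\<close>

lemma part_set_surj:
  assumes S: "S \<subseteq> {1..N}" "card S = n"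
  obtains la where "la \<in> partitions n (N - n)" "part_set la = S"
proof -
  let ?xs = "sorted_list_of_set S"
  have fin: "finite S" using S by (meson finite_atLeastAtMost finite_subset)
  have len: "length ?xs = n" using S by simp
  have mono: "?xs ! i < ?xs ! i'" if "i < i'" "i' < n" for i i'
    using strict_sorted_list_of_set[of S] that len by (simp add: sorted_wrt_iff_nth_less)
  have range: "1 \<le> ?xs ! i" "?xs ! i \<le> N" if "i < n" for i
    using nth_mem[of i ?xs] that len S fin by auto
  have gap: "?xs ! i + d \<le> ?xs ! (i + d)" if "i + d < n" for i d
    using that
  proof (induction d)
    case (Suc d)
    then show ?case using mono[of "i + d" "i + Suc d"] by simp
  qed simp
  have low: "Suc i \<le> ?xs ! i" if "i < n" for i
    using gap[of 0 i] range[of 0] that by simp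
  have high: "?xs ! i - Suc i \<le> N - n" if "i < n" for i
    using gap[of i "n - Suc i"] range(2)[of "n - Suc 0"] that by auto
  define la where "la = map (\<lambda>i. ?xs ! (n - Suc i) - (n - i)) [0..<n]"
  have "la \<in> partitions n (N - n)"
  proof -
    have "la ! i' \<le> la ! i" if "i < i'" "i' < n" for i i'
      using gap[of "n - Suc i'" "i' - i"] low[of "n - Suc i'"] that by (simp add: la_def)
    moreover have "x \<le> N - n" if "x \<in> set la" for x
    proof -
      obtain i where "i < n" "x = ?xs ! (n - Suc i) - (n - i)" using \<open>x \<in> set la\<close> by (auto simp: la_def)
      then show ?thesis using high[of "n - Suc i"] by (simp add: Suc_diff_Suc)
    qed
    ultimately show ?thesis
      by (auto simp: partitions_def sorted_wrt_iff_nth_less la_def)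
  qed
  moreover have "part_list la = ?xs"
  proof (rule nth_equalityI)
    show "length (part_list la) = length ?xs" using len by (simp add: part_list_def la_def)
    fix i assume "i < length (part_list la)"
    then have "i < n" by (simp add: part_list_def la_def)
    then have "n - Suc (n - Suc i) = i" "n - (n - Suc i) = Suc i" "n - Suc i < n" by auto
    then show "part_list la ! i = ?xs ! i"
      using \<open>i < n\<close> low[of i] by (simp add: part_list_def la_def del: length_sorted_list_of_set)
  qed
  then have "part_set la = S" using set_part_list[of la] fin by simp
  ultimately show ?thesis by (rule that)
qed

lemma factorial_schur_part_dual:
  assumes "la \<in> partitions n (N - n)" "n \<le> N"
  shows "factorial_schur (part_dual (N - n) la) xs a = schur_quot n (set_exponent N (part_set la)) xs a"
proof -
  have len: "length la = n" using assms(1) by (simp add: partitions_def)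
  have "part_dual (N - n) la ! i + (n - Suc i) = set_exponent N (part_set la) i" if "i < n" for i
  proof -
    have "la ! (n - Suc i) \<le> N - n"
      using that assms(1) len nth_mem[of "n - Suc i" la] by (auto simp: partitions_def)
    then show ?thesis
      using that assms(2) len
      by (simp add: part_dual_def rev_nth set_exponent_def sorted_list_of_part_set[OF assms(1)]
          part_list_def)
  qed
  then have "schur_det n (\<lambda>i. part_dual (N - n) la ! i + (n - Suc i)) xs a =
    schur_det n (set_exponent N (part_set la)) xs a"
    by (rule schur_det_cong)
  moreover have "length (part_dual (N - n) la) = n" using len by (simp add: part_dual_def)
  ultimately show ?thesis
    by (simp add: factorial_schur_def schur_quot_def schur_det_def)
qed

section \<open>The symmetric group on the field of the Bethe roots\<close>

lemma s_pol_eq_0_iff: "s_pol N j p = (0 :: 'c::comm_ring_1 mpol) \<longleftrightarrow> p = 0"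
proof -
  interpret comm_ring_hom "s_pol N j :: 'c mpol \<Rightarrow> 'c mpol" by (rule comm_ring_hom_s_pol)
  show ?thesis by (metis s_pol_involution hom_zero)
qed

lemma s_pol_1: "s_pol N j 1 = (1 :: 'c::comm_ring_1 mpol)"
proof -
  interpret comm_ring_hom "s_pol N j :: 'c mpol \<Rightarrow> 'c mpol" by (rule comm_ring_hom_s_pol)
  show ?thesis by (rule hom_one)
qed

lemma s_K_Fract:
  assumes "b \<noteq> 0"
  shows "s_K N j (Fract a b) = Fract (s_pol N j a) (s_pol N j b)"
  unfolding s_K_def
proof (rule the_equality)
  interpret comm_ring_hom "s_pol N j :: complex mpol \<Rightarrow> complex mpol" by (rule comm_ring_hom_s_pol)
  show "\<exists>a' b'. b' \<noteq> 0 \<and> Fract a b = Fract a' b' \<and>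
      Fract (s_pol N j a) (s_pol N j b) = Fract (s_pol N j a') (s_pol N j b')"
    using assms by blast
  fix r assume "\<exists>a' b'. b' \<noteq> 0 \<and> Fract a b = Fract a' b' \<and> r = Fract (s_pol N j a') (s_pol N j b')"
  then obtain a' b' where b': "b' \<noteq> 0" "Fract a b = Fract a' b'"
    and r: "r = Fract (s_pol N j a') (s_pol N j b')" by blast
  then have "a * b' = a' * b" using assms by (simp add: eq_fract)
  then have "s_pol N j a * s_pol N j b' = s_pol N j a' * s_pol N j b"
    by (metis hom_mult)
  then show "r = Fract (s_pol N j a) (s_pol N j b)"
    using assms b' by (simp add: r eq_fract s_pol_eq_0_iff)
qed

lemma comm_ring_hom_s_K: "comm_ring_hom (s_K N j)"
proof -
  interpret comm_ring_hom "s_pol N j :: complex mpol \<Rightarrow> complex mpol" by (rule comm_ring_hom_s_pol)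
  have mult: "s_K N j (x * y) = s_K N j x * s_K N j y"
    and add: "s_K N j (x + y) = s_K N j x + s_K N j y" for x y
  proof -
    obtain a b where x: "x = Fract a b" "b \<noteq> 0" by (cases x)
    obtain c d where y: "y = Fract c d" "d \<noteq> 0" by (cases y)
    show "s_K N j (x * y) = s_K N j x * s_K N j y" "s_K N j (x + y) = s_K N j x + s_K N j y"
      using x y by (simp_all add: s_K_Fract s_pol_eq_0_iff hom_mult hom_add)
  qed
  have "s_K N j 1 = 1" "s_K N j 0 = 0"
    by (simp_all add: One_fract_def Zero_fract_def s_K_Fract)
  then show ?thesis by unfold_locales (simp_all add: mult add)
qed

lemma s_K_T_K: "s_K N j (T_K i) = T_K (transpose (N + 1 - j) (N + 1 - cyc_succ N j) i)"
proof -
  interpret comm_ring_hom "s_pol N j :: complex mpol \<Rightarrow> complex mpol" by (rule comm_ring_hom_s_pol)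
  have "s_pol N j (T_var i) = (T_var (transpose (N + 1 - j) (N + 1 - cyc_succ N j) i) :: complex mpol)"
    unfolding s_pol_def by (rule swap_vars_T_var)
  then show ?thesis by (simp add: T_K_def s_K_Fract)
qed

lemma T_K_inject: "T_K i = T_K j \<longleftrightarrow> i = j"
  by (simp add: T_K_def eq_fract T_var_inject)

lemma nth_s_B: "fls_nth (s_B N j f) i = s_K N j (fls_nth f i)"
proof -
  interpret comm_ring_hom "s_K N j" by (rule comm_ring_hom_s_K)
  show ?thesis
    unfolding s_B_def
    by (rule nth_Abs_fls_lower_bound[of "fls_subdegree f"]) auto
qed

lemma s_K_eq_0_iff: "s_K N j x = 0 \<longleftrightarrow> x = 0"
proof -
  interpret comm_ring_hom "s_pol N j :: complex mpol \<Rightarrow> complex mpol" by (rule comm_ring_hom_s_pol)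
  obtain a b where x: "x = Fract a b" "b \<noteq> 0" by (cases x)
  then show ?thesis by (simp add: s_K_Fract Zero_fract_def eq_fract s_pol_eq_0_iff)
qed

text \<open>The coefficients of a product of Laurent series are sums over ranges bounded by the subdegrees of
the factors, so multiplicativity of \<open>s_B\<close> rests on this.\<close>

lemma subdegree_s_B: "fls_subdegree (s_B N j f) = fls_subdegree f"
proof (cases "f = 0")
  case True
  interpret comm_ring_hom "s_K N j" by (rule comm_ring_hom_s_K)
  from True have "s_B N j f = 0" by (intro fls_eqI) (simp add: nth_s_B)
  with True show ?thesis by simp
next
  case False
  interpret comm_ring_hom "s_K N j" by (rule comm_ring_hom_s_K)
  show ?thesis
    using False by (intro fls_subdegree_eqI) (auto simp: nth_s_B s_K_eq_0_iff)
qed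

lemma comm_ring_hom_s_B: "comm_ring_hom (s_B N j)"
proof -
  interpret comm_ring_hom "s_K N j" by (rule comm_ring_hom_s_K)
  show ?thesis
  proof unfold_locales
    show "s_B N j (f + g) = s_B N j f + s_B N j g" for f g
      by (intro fls_eqI) (simp add: nth_s_B hom_add)
    show "s_B N j 1 = 1" "s_B N j 0 = 0"
      by (intro fls_eqI; simp add: nth_s_B)+
    show "s_B N j (f * g) = s_B N j f * s_B N j g" for f g
      by (intro fls_eqI) (simp add: nth_s_B fls_times_nth(2) subdegree_s_B hom_sum hom_mult)
  qed
qed

lemma s_B_inverse: "s_B N j (inverse f) = inverse (s_B N j f)"
proof -
  interpret comm_ring_hom "s_B N j" by (rule comm_ring_hom_s_B)
  show ?thesis
  proof (cases "f = 0")
    case False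
    then have "s_B N j f * s_B N j (inverse f) = 1" by (simp flip: hom_mult)
    then show ?thesis by (simp add: inverse_unique)
  qed simp
qed

lemma s_B_divide: "s_B N j (f / g) = s_B N j f / s_B N j g"
proof -
  interpret comm_ring_hom "s_B N j" by (rule comm_ring_hom_s_B)
  show ?thesis by (simp add: divide_inverse hom_mult s_B_inverse)
qed

lemma s_B_T_B: "s_B N j (T_B i) = T_B (transpose (N + 1 - j) (N + 1 - cyc_succ N j) i)"
proof -
  interpret comm_ring_hom "s_K N j" by (rule comm_ring_hom_s_K)
  show ?thesis by (intro fls_eqI) (simp add: nth_s_B T_B_def s_K_T_K)
qed

section \<open>The Bethe roots\<close>

text \<open>Writing $y = t_j + z$ turns the equation into $H(z) = X$ for a power series $H$ without constant
term; its linear coefficient is a nonzero multiple of $\prod_{i \ne j}(t_j - t_i) \ne 0$. So $z$ must be the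
compositional inverse of $H$.\<close>

lemma fps_prod_root_ex1:
  fixes t :: "nat \<Rightarrow> 'a::field"
  assumes fin: "finite I" and j: "j \<in> I" and inj: "inj_on t I" and c: "c \<noteq> 0"
  shows "\<exists>!y. (\<Prod>i\<in>I. y - fps_const (t i)) + fps_const c * fps_X = 0 \<and> fps_nth y 0 = t j"
proof -
  define G where "G = (\<Prod>i\<in>I. fps_X + fps_const (t j - t i))"
  define H where "H = fps_const (- inverse c) * G"
  have G: "G = fps_X * (\<Prod>i\<in>I - {j}. fps_X + fps_const (t j - t i))"
    unfolding G_def using fin j by (subst prod.remove[of I j]) simp_all
  have nth0: "fps_nth (\<Prod>i\<in>J. fps_X + fps_const (t j - t i)) 0 = (\<Prod>i\<in>J. t j - t i)" for J
    by (induction J rule: infinite_finite_induct) simp_all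
  have "(\<Prod>i\<in>I - {j}. t j - t i) \<noteq> 0"
    using fin inj j by (auto simp: inj_on_def)
  then have H: "fps_nth H 0 = 0" "fps_nth H 1 \<noteq> 0"
    using c nth0[of "I - {j}"] by (simp_all add: H_def G)
  have eq: "(\<Prod>i\<in>I. y - fps_const (t i)) + fps_const c * fps_X = 0 \<longleftrightarrow>
      H oo (y - fps_const (t j)) = fps_X" if "fps_nth y 0 = t j" for y
  proof -
    have z: "fps_nth (y - fps_const (t j)) 0 = 0" using that by simp
    have "G oo (y - fps_const (t j)) = (\<Prod>i\<in>I. y - fps_const (t i))"
      unfolding G_def fps_compose_prod_distrib[OF z]
    proof (rule prod.cong[OF HOL.refl])
      fix i
      have "(fps_X + fps_const (t j - t i)) oo (y - fps_const (t j)) =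
          (y - fps_const (t j)) + fps_const (t j - t i)"
        by (simp only: fps_compose_add_distrib fps_X_fps_compose_startby0[OF z] fps_const_compose)
      also have "\<dots> = y - fps_const (t i)" by (simp flip: fps_const_sub)
      finally show "(fps_X + fps_const (t j - t i)) oo (y - fps_const (t j)) = y - fps_const (t i)" .
    qed
    then have *: "H oo (y - fps_const (t j)) = fps_const (- inverse c) * (\<Prod>i\<in>I. y - fps_const (t i))"
      unfolding H_def by (simp add: fps_compose_mult_distrib[OF z] del: fps_const_neg)
    show ?thesis
    proof
      assume "(\<Prod>i\<in>I. y - fps_const (t i)) + fps_const c * fps_X = 0"
      then have "(\<Prod>i\<in>I. y - fps_const (t i)) = - (fps_const c * fps_X)"
        by (simp add: add_eq_0_iff2)
      then show "H oo (y - fps_const (t j)) = fps_X"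
        unfolding * using c by (simp add: fps_eq_iff)
    next
      assume "H oo (y - fps_const (t j)) = fps_X"
      then have "fps_const c * (fps_const (- inverse c) * (\<Prod>i\<in>I. y - fps_const (t i))) =
          fps_const c * fps_X" by (simp only: *)
      then have "(fps_const c * fps_const (- inverse c)) * (\<Prod>i\<in>I. y - fps_const (t i)) =
          fps_const c * fps_X" by (simp only: mult.assoc)
      moreover have "fps_const c * fps_const (- inverse c) = - 1"
        using c by (simp flip: fps_const_neg)
      ultimately have "fps_const c * fps_X = - (\<Prod>i\<in>I. y - fps_const (t i))"
        by (simp only: mult_minus1)
      then show "(\<Prod>i\<in>I. y - fps_const (t i)) + fps_const c * fps_X = 0"
        by (simp only: add.right_inverse)
    qed
  qed
  show ?thesis
  proof (rule ex1I)
    let ?y = "fps_const (t j) + fps_inv H"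
    have "fps_nth ?y 0 = t j" by (simp add: fps_inv_def)
    then show "(\<Prod>i\<in>I. ?y - fps_const (t i)) + fps_const c * fps_X = 0 \<and> fps_nth ?y 0 = t j"
      using eq[of ?y] fps_inv_right[OF H] by simp
  next
    fix y assume y: "(\<Prod>i\<in>I. y - fps_const (t i)) + fps_const c * fps_X = 0 \<and> fps_nth y 0 = t j"
    let ?z = "y - fps_const (t j)"
    have z: "fps_nth ?z 0 = 0" using y by simp
    have "?z = (fps_inv H oo H) oo ?z"
      by (simp only: fps_inv[OF H] fps_X_fps_compose_startby0[OF z])
    also have "\<dots> = fps_inv H oo (H oo ?z)"
      by (rule fps_compose_assoc[OF z H(1), symmetric])
    also have "H oo ?z = fps_X" using eq y by blast
    also have "fps_inv H oo fps_X = fps_inv H" by simp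
    finally show "y = fps_const (t j) + fps_inv H" by (simp add: algebra_simps)
  qed
qed

text \<open>The condition that singles out the $j$-th Bethe root among power series in $q$.\<close>

definition bethe_eq :: "nat \<Rightarrow> nat \<Rightarrow> nat \<Rightarrow> ratfun fps \<Rightarrow> bool" where
  "bethe_eq N n j y \<longleftrightarrow>
     (\<Prod>i = 1..N. y - fps_const (T_K (N + 1 - i))) + (- 1) ^ n * fps_X = 0 \<and>
     fps_nth y 0 = T_K (N + 1 - j)"

lemma bethe_eq_ex1:
  assumes "j \<in> {1..N}"
  shows "\<exists>!y. bethe_eq N n j y"
proof -
  have "inj_on (\<lambda>i. T_K (N + 1 - i)) {1..N}"
    by (auto simp: inj_on_def T_K_inject)
  moreover have "fps_const ((-1) ^ n) = ((-1) ^ n :: ratfun fps)"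
    by (cases "even n") (simp_all flip: fps_const_neg)
  ultimately show ?thesis
    unfolding bethe_eq_def
    using fps_prod_root_ex1[of "{1..N}" j "\<lambda>i. T_K (N + 1 - i)" "(-1) ^ n"] assms
    by (simp only: finite_atLeastAtMost power_eq_0_iff neg_equal_0_iff_equal one_neq_zero simp_thms)
qed

text \<open>The restriction of \<open>s_B\<close> to power series, where the Bethe roots are characterised.\<close>

definition s_fps :: "nat \<Rightarrow> nat \<Rightarrow> ratfun fps \<Rightarrow> ratfun fps" where
  "s_fps N j y = Abs_fps (\<lambda>i. s_K N j (fps_nth y i))"

lemma comm_ring_hom_s_fps: "comm_ring_hom (s_fps N j)"
proof -
  interpret comm_ring_hom "s_K N j" by (rule comm_ring_hom_s_K)
  show ?thesis
    by unfold_locales (simp_all add: s_fps_def fps_eq_iff fps_mult_nth hom_add hom_sum hom_mult)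
qed

lemma s_B_fps_to_fls: "s_B N j (fps_to_fls y) = fps_to_fls (s_fps N j y)"
proof -
  interpret comm_ring_hom "s_K N j" by (rule comm_ring_hom_s_K)
  show ?thesis by (intro fls_eqI) (simp add: nth_s_B s_fps_def)
qed

text \<open>The transformed root solves the same equation, whose factors are only permuted, and has constant
term $s_j(t_i)$; uniqueness identifies it.\<close>

lemma s_B_bethe_root:
  assumes "i \<in> {1..N}" "1 \<le> j" "j < N"
  shows "s_B N j (bethe_root N n i) = bethe_root N n (transpose j (Suc j) i)"
proof -
  define y where "y k = (THE y. bethe_eq N n k y)" for k
  have root: "bethe_root N n k = fps_to_fls (y k)" for k
    by (simp add: bethe_root_def y_def bethe_eq_def)
  have y: "bethe_eq N n i (y i)"
    unfolding y_def using bethe_eq_ex1[OF assms(1)] by (rule theI')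
  let ?s = "transpose j (Suc j)"
  have si: "?s i \<in> {1..N}" using assms by (auto simp: transpose_def)
  interpret K: comm_ring_hom "s_K N j" by (rule comm_ring_hom_s_K)
  interpret F: comm_ring_hom "s_fps N j" by (rule comm_ring_hom_s_fps)
  have T: "s_K N j (T_K (N + 1 - k)) = T_K (N + 1 - ?s k)" if "k \<in> {1..N}" for k
  proof -
    have j: "j \<in> {1..N}" "cyc_succ N j = Suc j" using assms by (auto simp: cyc_succ_def)
    show ?thesis
      unfolding T_K_def s_K_Fract[OF one_neq_zero] s_pol_T_var[OF j(1) that] j(2) s_pol_1 ..
  qed
  have const: "s_fps N j (fps_const x) = fps_const (s_K N j x)" for x
    by (simp add: s_fps_def fps_eq_iff)
  have X: "s_fps N j fps_X = fps_X"
    by (simp add: s_fps_def fps_eq_iff fps_X_def)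
  have "s_fps N j ((\<Prod>k = 1..N. y i - fps_const (T_K (N + 1 - k))) + (- 1) ^ n * fps_X) = 0"
    using y by (simp add: bethe_eq_def)
  then have "(\<Prod>k = 1..N. s_fps N j (y i) - fps_const (s_K N j (T_K (N + 1 - k)))) + (- 1) ^ n * fps_X = 0"
    by (simp add: F.hom_add F.hom_mult F.hom_power F.hom_prod F.hom_minus F.hom_uminus const X)
  moreover have "(\<Prod>k = 1..N. s_fps N j (y i) - fps_const (s_K N j (T_K (N + 1 - k)))) =
      (\<Prod>k = 1..N. s_fps N j (y i) - fps_const (T_K (N + 1 - ?s k)))"
    by (intro prod.cong HOL.refl) (simp only: T)
  moreover have "(\<Prod>k = 1..N. s_fps N j (y i) - fps_const (T_K (N + 1 - ?s k))) =
      (\<Prod>k = 1..N. s_fps N j (y i) - fps_const (T_K (N + 1 - k)))"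
  proof -
    have "?s permutes {1..N}" using assms by (intro permutes_swap_id) auto
    from prod.permute[OF this, of "\<lambda>k. s_fps N j (y i) - fps_const (T_K (N + 1 - k))"]
    show ?thesis by (simp add: comp_def)
  qed
  moreover have "fps_nth (s_fps N j (y i)) 0 = T_K (N + 1 - ?s i)"
    using y T[OF assms(1)] by (simp add: s_fps_def bethe_eq_def)
  ultimately have "bethe_eq N n (?s i) (s_fps N j (y i))"
    by (simp add: bethe_eq_def)
  then have "y (?s i) = s_fps N j (y i)"
    unfolding y_def using bethe_eq_ex1[OF si] by (intro the1_equality)
  then show ?thesis by (simp add: root s_B_fps_to_fls)
qed

section \<open>Bethe vectors\<close>

text \<open>The coordinate at the set $S$ of the vector $|y_\alpha\rangle$ with $I(\alpha) = I$. Cosets of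
$\mathbb{S}_n \times \mathbb{S}_k$ determine the subset directly and the partition only through it.\<close>

definition bethe_set_coeff :: "nat \<Rightarrow> nat \<Rightarrow> nat set \<Rightarrow> nat set \<Rightarrow> bfield" where
  "bethe_set_coeff N n I S =
     (if S \<subseteq> {1..N} \<and> card S = n
      then schur_quot n (set_exponent N S) (map (bethe_root N n) (sorted_list_of_set I)) T_B else 0)"

definition bethe_set_euler :: "nat \<Rightarrow> nat \<Rightarrow> nat set \<Rightarrow> bfield" where
  "bethe_set_euler N n I = (\<Prod>i \<in> I. \<Prod>j \<in> {1..N} - I. bethe_root N n i - bethe_root N n j)"

lemma finite_partitions: "finite (partitions n k)"
  by (rule finite_subset[OF _ finite_lists_length_eq[of "{..k}" n]]) (auto simp: partitions_def)

lemma bethe_Y_eq: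
  assumes "n \<le> N" "\<alpha> \<in> partitions n (N - n)"
  shows "bethe_Y N n \<alpha> S =
    inverse (bethe_set_euler N n (part_set \<alpha>)) * bethe_set_coeff N n (part_set \<alpha>) S"
proof -
  let ?ys = "bethe_tuple N n \<alpha>"
  have summand: "factorial_schur (part_dual (N - n) la) ?ys T_B * basis_vec (part_set la) S =
      (if part_set la = S then bethe_set_coeff N n (part_set \<alpha>) S else 0)"
    if "la \<in> partitions n (N - n)" for la
    using that assms(1) part_set_subset[OF that assms(1)]
    by (auto simp: basis_vec_def factorial_schur_part_dual bethe_set_coeff_def bethe_tuple_def)
  have "bethe_vec N n \<alpha> S =
      (\<Sum>la \<in> partitions n (N - n). if part_set la = S then bethe_set_coeff N n (part_set \<alpha>) S else 0)"
    unfolding bethe_vec_def by (rule sum.cong[OF HOL.refl summand])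
  also have "\<dots> = bethe_set_coeff N n (part_set \<alpha>) S"
  proof (cases "S \<subseteq> {1..N} \<and> card S = n")
    case True
    then obtain mu where mu: "mu \<in> partitions n (N - n)" "part_set mu = S"
      using part_set_surj by metis
    have "part_set la = S \<longleftrightarrow> la = mu" if "la \<in> partitions n (N - n)" for la
      using part_set_inject[OF that mu(1)] mu(2) by auto
    then have "(\<Sum>la \<in> partitions n (N - n). if part_set la = S then bethe_set_coeff N n (part_set \<alpha>) S else 0) =
      (\<Sum>la \<in> partitions n (N - n). if la = mu then bethe_set_coeff N n (part_set \<alpha>) S else 0)"
      by (intro sum.cong) simp_all
    then show ?thesis using mu(1) finite_partitions by simp
  next
    case False
    then have "bethe_set_coeff N n (part_set \<alpha>) S = 0"
      unfolding bethe_set_coeff_def by (rule if_not_P)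
    then show ?thesis by (simp cong: if_cong)
  qed
  finally show ?thesis
    by (simp add: bethe_Y_def vec_scale_def bethe_euler_def bethe_set_euler_def)
qed

text \<open>All representatives of the coset of $w$ send $\{1,\dots,n\}$ to the same set.\<close>

lemma coset_part_spec:
  assumes "n \<le> N" "w permutes {1..N}"
  shows "coset_part N n (coset_of N n w) \<in> partitions n (N - n)"
    and "part_set (coset_part N n (coset_of N n w)) = w ` {1..n}"
proof -
  have image: "v ` {1..n} = w ` {1..n}" if "v \<in> coset_of N n w" for v
  proof -
    have "\<exists>x \<in> block_subgroup N n. v = w \<circ> x"
      using that by (auto simp: coset_of_def l_coset_def sym_group_def)
    then obtain x where "v = w \<circ> x" "x ` {1..n} = {1..n}"
      unfolding block_subgroup_def by blast
    then show ?thesis by (metis image_comp)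
  qed
  have "id \<in> block_subgroup N n"
    by (simp add: block_subgroup_def sym_group_def permutes_id)
  then have w: "w \<in> coset_of N n w"
    unfolding coset_of_def l_coset_def by (auto simp: sym_group_def intro!: bexI[of _ id])
  have "w ` {1..n} \<subseteq> {1..N}"
    using assms permutes_image[OF assms(2)] by (metis atLeastatMost_subset_iff image_mono order_refl)
  moreover have "card (w ` {1..n}) = n"
    using permutes_inj[OF assms(2)] by (simp add: card_image inj_on_subset)
  ultimately obtain la where la: "la \<in> partitions n (N - n)" "part_set la = w ` {1..n}"
    using part_set_surj by metis
  have "coset_part N n (coset_of N n w) = la"
    unfolding coset_part_def
  proof (rule the_equality)
    show "la \<in> partitions n (N - n) \<and> (\<forall>v\<in>coset_of N n w. part_set la = v ` {1..n})"
      using la image by simp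
    fix mu assume "mu \<in> partitions n (N - n) \<and> (\<forall>v\<in>coset_of N n w. part_set mu = v ` {1..n})"
    then show "mu = la" using la w part_set_inject by metis
  qed
  with la show "coset_part N n (coset_of N n w) \<in> partitions n (N - n)"
    "part_set (coset_part N n (coset_of N n w)) = w ` {1..n}" by simp_all
qed

lemma s_B_bethe_set_euler:
  assumes I: "I \<subseteq> {1..N}" and j: "1 \<le> j" "j < N"
  shows "s_B N j (bethe_set_euler N n I) = bethe_set_euler N n (transpose j (Suc j) ` I)"
proof -
  let ?s = "transpose j (Suc j)" and ?y = "bethe_root N n"
  interpret comm_ring_hom "s_B N j" by (rule comm_ring_hom_s_B)
  have inj: "inj_on ?s A" for A by (rule inj_on_subset[OF inj_transpose]) simp
  have "?s ` {1..N} = {1..N}" using j by (intro permutes_image permutes_swap_id) auto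
  then have compl: "{1..N} - ?s ` I = ?s ` ({1..N} - I)"
    by (simp add: image_set_diff[OF inj_transpose])
  have "s_B N j (bethe_set_euler N n I) = (\<Prod>i \<in> I. \<Prod>k \<in> {1..N} - I. s_B N j (?y i) - s_B N j (?y k))"
    by (simp add: bethe_set_euler_def hom_prod hom_minus)
  also have "\<dots> = (\<Prod>i \<in> I. \<Prod>k \<in> {1..N} - I. ?y (?s i) - ?y (?s k))"
  proof (intro prod.cong HOL.refl)
    fix i k assume "i \<in> I" "k \<in> {1..N} - I"
    then have "i \<in> {1..N}" "k \<in> {1..N}" using I by auto
    then show "s_B N j (?y i) - s_B N j (?y k) = ?y (?s i) - ?y (?s k)"
      using j by (simp only: s_B_bethe_root)
  qed
  also have "\<dots> = (\<Prod>i \<in> ?s ` I. \<Prod>k \<in> ?s ` ({1..N} - I). ?y i - ?y k)"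
    by (simp only: prod.reindex[OF inj] comp_def)
  also have "\<dots> = bethe_set_euler N n (?s ` I)"
    by (simp only: bethe_set_euler_def compl)
  finally show ?thesis .
qed

lemma s_B_factorial_power: "s_B N j (factorial_power x a r) = factorial_power (s_B N j x) (\<lambda>i. s_B N j (a i)) r"
proof -
  interpret comm_ring_hom "s_B N j" by (rule comm_ring_hom_s_B)
  show ?thesis by (simp add: factorial_power_def hom_prod hom_minus)
qed

lemma s_B_schur_det:
  assumes "length xs = n"
  shows "s_B N j (schur_det n e xs a) = schur_det n e (map (s_B N j) xs) (\<lambda>i. s_B N j (a i))"
proof -
  interpret comm_ring_hom "s_B N j" by (rule comm_ring_hom_s_B)
  show ?thesis
    unfolding schur_det_def hom_det[symmetric]
    by (rule arg_cong[where f = det], rule eq_matI) (simp_all add: s_B_factorial_power assms)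
qed

lemma s_B_schur_quot:
  "length xs = n \<Longrightarrow>
    s_B N j (schur_quot n e xs a) = schur_quot n e (map (s_B N j) xs) (\<lambda>i. s_B N j (a i))"
  by (simp add: schur_quot_def s_B_divide s_B_schur_det)

lemma s_B_T_B_comp:
  assumes "1 \<le> j" "j < N"
  shows "(\<lambda>i. s_B N j (T_B i)) = T_B \<circ> transpose (N - j) (Suc (N - j))"
proof
  fix i
  have "cyc_succ N j = Suc j" "N + 1 - j = Suc (N - j)" "N + 1 - Suc j = N - j"
    using assms by (auto simp: cyc_succ_def)
  then show "s_B N j (T_B i) = (T_B \<circ> transpose (N - j) (Suc (N - j))) i"
    by (simp only: s_B_T_B comp_def transpose_commute)
qed

text \<open>The parameters and the roots are permuted simultaneously. The roots become those of $s_j(I)$ in a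
possibly different order, which symmetry allows for; the parameters contribute the correction term of
\<open>schur_quot_swap\<close>.\<close>

lemma s_B_bethe_set_coeff:
  assumes I: "I \<subseteq> {1..N}" "card I = n" and S: "S \<subseteq> {1..N}" "card S = n" and j: "1 \<le> j" "j < N"
  shows "s_B N j (bethe_set_coeff N n I S) =
    bethe_set_coeff N n (transpose j (Suc j) ` I) S +
      (if j \<in> S \<and> Suc j \<notin> S
       then (t_B N (Suc j) - t_B N j) *
         bethe_set_coeff N n (transpose j (Suc j) ` I) (insert (Suc j) (S - {j})) else 0)"
proof -
  let ?s = "transpose j (Suc j)" and ?y = "bethe_root N n"
  let ?xs = "map ?y (sorted_list_of_set I)" and ?zs = "map ?y (sorted_list_of_set (?s ` I))"
  have finI: "finite I" using I by (meson finite_atLeastAtMost finite_subset)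
  have finS: "finite S" using S by (meson finite_atLeastAtMost finite_subset)
  have len: "length ?xs = n" "length (map (s_B N j) ?xs) = n" using I by simp_all
  have sorted: "mset (sorted_list_of_set A) = mset_set A" if "finite A" for A :: "nat set"
    using that by (metis distinct_sorted_list_of_set mset_set_set set_sorted_list_of_set)
  have inj: "inj_on ?s A" for A by (rule inj_on_subset[OF inj_transpose]) simp
  have "map (s_B N j) ?xs = map (\<lambda>i. ?y (?s i)) (sorted_list_of_set I)"
    using I(1) finI j by (auto intro!: s_B_bethe_root)
  then have "mset (map (s_B N j) ?xs) = image_mset ?y (image_mset ?s (mset (sorted_list_of_set I)))"
    by (simp only: mset_map multiset.map_comp comp_def)
  also have "\<dots> = mset ?zs"
    using finI by (simp add: sorted image_mset_mset_set[OF inj])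
  finally have mset: "mset (map (s_B N j) ?xs) = mset ?zs" .
  have perm: "schur_quot n e (map (s_B N j) ?xs) T_B = schur_quot n e ?zs T_B" for e
    by (rule schur_quot_permute[OF mset len(2)])
  have coeff: "schur_quot n (set_exponent N S') ?zs T_B = bethe_set_coeff N n (?s ` I) S'"
    if "S' \<subseteq> {1..N}" "card S' = n" for S'
    using that by (simp add: bethe_set_coeff_def)
  have T: "T_B (N - j) = t_B N (Suc j)" "T_B (Suc (N - j)) = t_B N j"
    using j by (simp_all add: t_B_def Suc_diff_le)
  have S': "insert (Suc j) (S - {j}) \<subseteq> {1..N}" "card (insert (Suc j) (S - {j})) = n"
    if "j \<in> S" "Suc j \<notin> S"
  proof -
    show "insert (Suc j) (S - {j}) \<subseteq> {1..N}" using S(1) j by auto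
    show "card (insert (Suc j) (S - {j})) = n"
      using that finS S(2) by (metis Diff_iff finite_Diff card_insert_disjoint card_Suc_Diff1)
  qed
  have "s_B N j (bethe_set_coeff N n I S) =
    schur_quot n (set_exponent N S) (map (s_B N j) ?xs) (T_B \<circ> transpose (N - j) (Suc (N - j)))"
    using S by (simp add: bethe_set_coeff_def s_B_schur_quot[OF len(1)] s_B_T_B_comp[OF j] del: map_map)
  also have "\<dots> = schur_quot n (set_exponent N S) ?zs T_B +
      (if j \<in> S \<and> Suc j \<notin> S
       then (T_B (N - j) - T_B (Suc (N - j))) *
         schur_quot n (set_exponent N (insert (Suc j) (S - {j}))) ?zs T_B else 0)"
    unfolding schur_quot_swap[OF S j] perm ..
  also have "\<dots> = bethe_set_coeff N n (?s ` I) S +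
      (if j \<in> S \<and> Suc j \<notin> S
       then (t_B N (Suc j) - t_B N j) * bethe_set_coeff N n (?s ` I) (insert (Suc j) (S - {j})) else 0)"
    unfolding T coeff[OF S]
    by (rule arg_cong[where f = "(+) _"], rule if_cong[OF HOL.refl _ HOL.refl])
      (simp only: coeff[OF S'] simp_thms)
  finally show ?thesis .
qed

text \<open>If $j \in S$ and $j + 1 \notin S$, the exchange adds $t_j - t_{j+1}$ times the transformed coordinate
at $S'$, which has no correction of its own since $j \notin S'$; this cancels the correction at $S$.
For all other $S$ neither term is present.\<close>

theorem bs_B_bethe_set:
  assumes I: "I \<subseteq> {1..N}" "card I = n" and j: "1 \<le> j" "j < N"
  shows "bs_B N j (\<lambda>S. inverse (bethe_set_euler N n I) * bethe_set_coeff N n I S) =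
    (\<lambda>S. inverse (bethe_set_euler N n (transpose j (Suc j) ` I)) *
      bethe_set_coeff N n (transpose j (Suc j) ` I) S)"
proof
  fix S
  let ?s = "transpose j (Suc j)"
  let ?e = "inverse (bethe_set_euler N n I)" and ?e' = "inverse (bethe_set_euler N n (?s ` I))"
  let ?S' = "insert (Suc j) (S - {j})"
  let ?c = "t_B N j - t_B N (Suc j)"
  interpret comm_ring_hom "s_B N j" by (rule comm_ring_hom_s_B)
  have succ: "cyc_succ N j = Suc j" "cyc_succ N j \<noteq> j" using j by (auto simp: cyc_succ_def)
  have bs: "bs_B N j v S = s_B N j (v S - (if j \<in> S \<and> Suc j \<notin> S then ?c * v ?S' else 0))" for v
    unfolding bs_B_def affine_op_eq_exchange_op[OF succ(2)] exchange_op_def succ(1) using j by simp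
  have e: "s_B N j ?e = ?e'"
    by (simp only: s_B_inverse s_B_bethe_set_euler[OF I(1) j])
  have "s_B N j (t_B N j) = T_B (transpose (N - j) (Suc (N - j)) (N + 1 - j))"
    "s_B N j (t_B N (Suc j)) = T_B (transpose (N - j) (Suc (N - j)) (N + 1 - Suc j))"
    using fun_cong[OF s_B_T_B_comp[OF j]] by (simp_all only: t_B_def comp_def)
  moreover have "N + 1 - j = Suc (N - j)" "N + 1 - Suc j = N - j" using j by auto
  ultimately have c: "s_B N j ?c = - ?c"
    by (simp only: hom_minus t_B_def transpose_apply_first transpose_apply_second minus_diff_eq)
  show "bs_B N j (\<lambda>S. ?e * bethe_set_coeff N n I S) S = ?e' * bethe_set_coeff N n (?s ` I) S"
  proof (cases "S \<subseteq> {1..N} \<and> card S = n")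
    case True
    then have S: "S \<subseteq> {1..N}" "card S = n" by auto
    note step = s_B_bethe_set_coeff[OF I _ _ j]
    show ?thesis
    proof (cases "j \<in> S \<and> Suc j \<notin> S")
      case False
      then show ?thesis by (simp only: bs if_False diff_zero hom_mult e step[OF S] add_0_right)
    next
      case jS: True
      have "?S' \<subseteq> {1..N}" using S(1) j by auto
      moreover have "finite S" using S(1) by (rule finite_subset) simp
      then have "card ?S' = n"
        using jS S(2) by (metis Diff_iff finite_Diff card_insert_disjoint card_Suc_Diff1)
      ultimately have S': "?S' \<subseteq> {1..N}" "card ?S' = n" .
      have "j \<notin> ?S'" by simp
      then have "s_B N j (bethe_set_coeff N n I ?S') = bethe_set_coeff N n (?s ` I) ?S'"
        by (simp only: step[OF S'] simp_thms if_False add_0_right)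
      moreover have "s_B N j (bethe_set_coeff N n I S) =
          bethe_set_coeff N n (?s ` I) S - ?c * bethe_set_coeff N n (?s ` I) ?S'"
        using jS by (simp add: step[OF S] algebra_simps)
      moreover have "s_B N j (x * y - c * (x * z)) = s_B N j x * s_B N j y - s_B N j c * (s_B N j x * s_B N j z)"
        for x y z c by (simp add: hom_minus hom_mult)
      ultimately have "bs_B N j (\<lambda>S. ?e * bethe_set_coeff N n I S) S =
          ?e' * (bethe_set_coeff N n (?s ` I) S - ?c * bethe_set_coeff N n (?s ` I) ?S') -
          (- ?c) * (?e' * bethe_set_coeff N n (?s ` I) ?S')"
        using jS by (simp only: bs if_True simp_thms e c)
      then show ?thesis by (simp add: algebra_simps)
    qed
  next
    case False
    have "bethe_set_coeff N n I ?S' = 0" if "j \<in> S" "Suc j \<notin> S"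
    proof -
      have "S \<subseteq> {1..N}" "card S = n" if "?S' \<subseteq> {1..N}" "card ?S' = n"
      proof -
        have "S \<subseteq> insert j ?S'" by auto
        then show "S \<subseteq> {1..N}" using that(1) j by auto
        then have "finite S" by (rule finite_subset) simp
        then show "card S = n"
          using that(2) \<open>j \<in> S\<close> \<open>Suc j \<notin> S\<close>
          by (metis Diff_iff finite_Diff card_insert_disjoint card_Suc_Diff1)
      qed
      then show ?thesis using False by (auto simp: bethe_set_coeff_def)
    qed
    moreover have "bethe_set_coeff N n J S = 0" for J
      unfolding bethe_set_coeff_def using False by (rule if_not_P)
    ultimately show ?thesis by (simp add: bs)
  qed
qed

theorem bs_B_Y_coset:
  assumes "n \<le> N" "j \<in> {1..<N}" "w \<in> carrier (sym_group N)"
  shows "bs_B N j (Y_coset N n (coset_of N n w)) =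
    Y_coset N n (coset_of N n (transpose j (j + 1) \<circ> w))"
proof -
  have w: "w permutes {1..N}" using assms(3) by (simp add: sym_group_def)
  have j: "1 \<le> j" "j < N" using assms(2) by auto
  let ?s = "transpose j (Suc j)"
  have "?s permutes {1..N}" using j by (intro permutes_swap_id) auto
  then have sw: "?s \<circ> w permutes {1..N}" by (rule permutes_compose[OF w])
  have Y: "Y_coset N n (coset_of N n v) =
      (\<lambda>S. inverse (bethe_set_euler N n (v ` {1..n})) * bethe_set_coeff N n (v ` {1..n}) S)"
    if "v permutes {1..N}" for v
    using bethe_Y_eq[OF assms(1) coset_part_spec(1)[OF assms(1) that]]
    unfolding Y_coset_def coset_part_spec(2)[OF assms(1) that] by (rule ext)
  have "w ` {1..n} \<subseteq> {1..N}" "card (w ` {1..n}) = n"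
    using part_set_subset[OF coset_part_spec(1)[OF assms(1) w] assms(1)]
    by (simp_all only: coset_part_spec(2)[OF assms(1) w])
  from bs_B_bethe_set[OF this j] show ?thesis
    by (simp only: Y[OF w] Y[OF sw] image_comp Suc_eq_plus1[symmetric])
qed

theorem theorem1p3:
  fixes N n :: nat
  assumes "N \<ge> 2" and "n \<le> N"
  shows
    "((\<exists>\<phi>. group_action (affine_sym N) (weight_space N n (LamQ_inv N)) \<phi> \<and>
           (\<forall>j \<in> {1..N}. \<forall>v \<in> weight_space N n (LamQ_inv N). \<phi> (affine_gen N j) v = bs_L N j v)) \<and>
      (\<forall>j \<in> {1..N}. \<forall>v \<in> weight_space N n (LamQ_inv N). \<forall>w \<in> weight_space N n (LamQ_inv N).
           \<forall>p \<in> LamQ_inv N.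
           bs_L N j (vec_add v w) = vec_add (bs_L N j v) (bs_L N j w) \<and>
           bs_L N j (vec_scale p v) = vec_scale (s_L N j p) (bs_L N j v)) \<and>
      (0 < n \<and> n < N \<longrightarrow>
           (\<exists>v \<in> weight_space N n (LamQ_const N). bs_L N N v \<notin> weight_space N n (LamQ_const N))))
     \<and>
     ((\<forall>j \<in> {1..<N}. \<forall>v \<in> tensor_space N (poly_in_x (LamQ N)).
           bs_X N j v \<in> tensor_space N (poly_in_x (LamQ N)) \<and>
           bs_X N j (entry_A (M_X N) v) = entry_A (M_X N) (bs_X N j v) \<and>
           bs_X N j (entry_B (M_X N) v) = entry_B (M_X N) (bs_X N j v) \<and>
           bs_X N j (entry_C (M_X N) v) = entry_C (M_X N) (bs_X N j v) \<and>
           bs_X N j (entry_D (M_X N) v) = entry_D (M_X N) (bs_X N j v)) \<and>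
      (\<forall>j \<in> {1..N}. \<forall>v \<in> weight_space N n (poly_in_x (LamQ_inv N)).
           bs_X N j (H_X N v) = H_X N (bs_X N j v) \<and>
           bs_X N j (E_X N v) = E_X N (bs_X N j v)))
     \<and>
     (\<forall>j \<in> {1..<N}. \<forall>w \<in> carrier (sym_group N).
           bs_B N j (Y_coset N n (coset_of N n w)) =
           Y_coset N n (coset_of N n (transpose j (j + 1) \<circ> w)))"
proof (intro conjI)
  show "\<exists>\<phi>. group_action (affine_sym N) (weight_space N n (LamQ_inv N)) \<phi> \<and>
      (\<forall>j \<in> {1..N}. \<forall>v \<in> weight_space N n (LamQ_inv N). \<phi> (affine_gen N j) v = bs_L N j v)"
    by (rule affine_sym_action)
      (use assms(1) bs_L_weight_space bs_L_involution bs_L_braid bs_L_commute in \<open>blast+\<close>)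
  show "\<forall>j \<in> {1..N}. \<forall>v \<in> weight_space N n (LamQ_inv N). \<forall>w \<in> weight_space N n (LamQ_inv N).
      \<forall>p \<in> LamQ_inv N.
      bs_L N j (vec_add v w) = vec_add (bs_L N j v) (bs_L N j w) \<and>
      bs_L N j (vec_scale p v) = vec_scale (s_L N j p) (bs_L N j v)"
    using bs_L_semilinear[OF assms(1)] unfolding semilinear_op_def by blast
  show "0 < n \<and> n < N \<longrightarrow>
      (\<exists>v \<in> weight_space N n (LamQ_const N). bs_L N N v \<notin> weight_space N n (LamQ_const N))"
    using bs_L_N_not_const assms(1) by blast
  show "\<forall>j \<in> {1..<N}. \<forall>v \<in> tensor_space N (poly_in_x (LamQ N)).
      bs_X N j v \<in> tensor_space N (poly_in_x (LamQ N)) \<and>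
      bs_X N j (entry_A (M_X N) v) = entry_A (M_X N) (bs_X N j v) \<and>
      bs_X N j (entry_B (M_X N) v) = entry_B (M_X N) (bs_X N j v) \<and>
      bs_X N j (entry_C (M_X N) v) = entry_C (M_X N) (bs_X N j v) \<and>
      bs_X N j (entry_D (M_X N) v) = entry_D (M_X N) (bs_X N j v)"
    using bs_X_tensor_space[OF assms(1)] bs_X_monodromy[OF assms(1)]
    unfolding entrywise_def op_commute_def by blast
  show "\<forall>j \<in> {1..N}. \<forall>v \<in> weight_space N n (poly_in_x (LamQ_inv N)).
      bs_X N j (H_X N v) = H_X N (bs_X N j v) \<and> bs_X N j (E_X N v) = E_X N (bs_X N j v)"
    using bs_X_transfer[OF assms(1)] unfolding op_commute_def by blast
  show "\<forall>j \<in> {1..<N}. \<forall>w \<in> carrier (sym_group N).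
      bs_B N j (Y_coset N n (coset_of N n w)) = Y_coset N n (coset_of N n (transpose j (j + 1) \<circ> w))"
    using bs_B_Y_coset[OF assms(2)] by blast
qed

end
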